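(* Let $u$ be a multi-circled plurisubharmonic singularity at $0\in\mathbb{C}^n$, and let $\alpha\in\mathbb{Z}^n$ with $\alpha_j\ge0$ for all $j$. Then $z^\alpha\in\mathcal J(u)$ if and only if $\alpha+\mathbf 1\in\mathrm{int}\,\Gamma_u$, where $\mathcal J(u)$ is the multiplier ideal of $u$, $\Gamma_u$ is the indicator diagram of $u$, and $\mathbf 1=(1,\dots,1)$.
   Context: A germ $u$ at $0\in\mathbb{C}^n$ of a plurisubharmonic function ($u\not\equiv-\infty$) is a multi-circled singularity if $u(z)=u(|z_1|,\dots,|z_n|)$. The multiplier ideal $\mathcal J(u)$ is the set of germs $f$ of holomorphic functions at $0$ such that $|f|e^{-u}\in L^2_{loc}$ near $0$. Let $\mathbb{R}^n_\pm=\{a\in\mathbb{R}^n:\ \pm a_j>0,\ 1\le j\le n\}$. For $a\in\mathbb{R}^n_+$ put $\phi_a(x)=\max_k a_k^{-1}\log|x_k|$ and $\nu_u(a)=\liminf_{x\to0}u(x)/\phi_a(x)$. Put $\widehat\Psi_u(t)=-\nu_u(-t)$ for $t\in\mathbb{R}^n_-$ (the convex image of the indicator $\Psi_u$ of $u$, i.e. $\widehat\Psi_u(t)=\Psi_u(e^{t_1},\dots,e^{t_n})$). The indicator diagram of $u$ is the closed convex set $$\Gamma_u=\{a\in\overline{\mathbb{R}^n_+}:\ \langle a,t\rangle\le\widehat\Psi_u(t)\ \ \forall t\in\mathbb{R}^n_-\}.$$ *)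

theory Defs
  imports "HOL-Analysis.Analysis"
begin

text \<open>
  Germs at the origin are represented by total functions; only their values near \<open>0\<close> matter,
  and all germ-level notions below are invariant under changing a function away from \<open>0\<close>.
\<close>

subsection \<open>Logarithm and exponential with the values at \<open>0\<close> and \<open>\<plusminus>\<infinity>\<close>\<close>

text \<open>The library has \<open>ln 0 = 0\<close>, whereas here \<open>log 0 = -\<infinity>\<close> is needed.\<close>

definition elog :: "real \<Rightarrow> ereal" where
  "elog r = (if r \<le> 0 then -\<infinity> else ereal (ln r))"

definition eexp :: "ereal \<Rightarrow> ennreal" where
  "eexp x = (case x of ereal r \<Rightarrow> ennreal (exp r) | PInfty \<Rightarrow> \<infinity> | MInfty \<Rightarrow> 0)"

subsection \<open>Plurisubharmonic functions\<close>

definition usc_on :: "'a::topological_space set \<Rightarrow> ('a \<Rightarrow> ereal) \<Rightarrow> bool" where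
  "usc_on S u \<longleftrightarrow> (\<forall>x\<in>S. \<forall>c. u x < c \<longrightarrow> (\<forall>\<^sub>F y in at x within S. u y < c))"

text \<open>
  \<open>(2\<pi>)\<^sup>-\<^sup>1 \<integral> u(z + e\<^sup>i\<^sup>\<theta> w) d\<theta>\<close> over \<open>[0, 2\<pi>]\<close>, as the integral of the positive part minus
  that of the negative part (\<^const>\<open>e2ennreal\<close> sends negative values to \<open>0\<close>). It is used only
  for \<open>u\<close> upper semicontinuous and \<open>< \<infinity>\<close> on the circle, where the first integral is finite.
\<close>

definition circle_mean :: "(complex ^ 'n \<Rightarrow> ereal) \<Rightarrow> complex ^ 'n \<Rightarrow> complex ^ 'n \<Rightarrow> ereal" where
  "circle_mean u z w =
     (enn2ereal (\<integral>\<^sup>+\<theta>\<in>{0..2 * pi}. e2ennreal (u (z + cis \<theta> *s w)) \<partial>lborel)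
      - enn2ereal (\<integral>\<^sup>+\<theta>\<in>{0..2 * pi}. e2ennreal (- u (z + cis \<theta> *s w)) \<partial>lborel))
     / ereal (2 * pi)"

text \<open>The function \<open>-\<infinity>\<close> is admitted here and excluded separately below.\<close>

definition psh_on :: "(complex ^ 'n) set \<Rightarrow> (complex ^ 'n \<Rightarrow> ereal) \<Rightarrow> bool" where
  "psh_on \<Omega> u \<longleftrightarrow>
     (\<forall>z\<in>\<Omega>. u z < \<infinity>) \<and> usc_on \<Omega> u \<and>
     (\<forall>z w. (\<forall>\<zeta>. cmod \<zeta> \<le> 1 \<longrightarrow> z + \<zeta> *s w \<in> \<Omega>) \<longrightarrow> u z \<le> circle_mean u z w)"

definition multi_circled_singularity :: "(complex ^ 'n \<Rightarrow> ereal) \<Rightarrow> bool" where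
  "multi_circled_singularity u \<longleftrightarrow>
     (\<exists>\<Omega>. open \<Omega> \<and> 0 \<in> \<Omega> \<and> psh_on \<Omega> u) \<and>
     \<not> (\<forall>\<^sub>F z in nhds 0. u z = -\<infinity>) \<and>
     (\<forall>\<^sub>F z in nhds 0. u z = u (\<chi> j. complex_of_real (cmod (z $ j))))"

subsection \<open>The multiplier ideal\<close>

text \<open>
  The library's \<open>holomorphic_on\<close> covers functions of one complex variable only. In several
  variables: real Frechet differentiability with complex linear derivative.
\<close>

definition holomorphic_sev_on :: "(complex ^ 'n \<Rightarrow> complex) \<Rightarrow> (complex ^ 'n) set \<Rightarrow> bool" where
  "holomorphic_sev_on f V \<longleftrightarrow>
     (\<forall>z\<in>V. \<exists>D. (f has_derivative D) (at z) \<and> (\<forall>c v. D (c *s v) = c * D v))"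

definition L2_loc_on :: "'a::euclidean_space set \<Rightarrow> ('a \<Rightarrow> ennreal) \<Rightarrow> bool" where
  "L2_loc_on V g \<longleftrightarrow>
     (\<forall>K. compact K \<and> K \<subseteq> V \<longrightarrow>
        g \<in> borel_measurable (lebesgue_on K) \<and> (\<integral>\<^sup>+z. (g z)\<^sup>2 \<partial>lebesgue_on K) < \<infinity>)"

definition multiplier_ideal :: "(complex ^ 'n \<Rightarrow> ereal) \<Rightarrow> (complex ^ 'n \<Rightarrow> complex) set" where
  "multiplier_ideal u =
     {f. \<exists>V. open V \<and> 0 \<in> V \<and> holomorphic_sev_on f V \<and>
             L2_loc_on V (\<lambda>z. ennreal (cmod (f z)) * eexp (- u z))}"

definition monomial :: "int ^ 'n \<Rightarrow> complex ^ 'n \<Rightarrow> complex" where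
  "monomial \<alpha> z = (\<Prod>j\<in>UNIV. (z $ j) powi (\<alpha> $ j))"

subsection \<open>The indicator diagram\<close>

definition pos_orthant :: "(real ^ 'n) set" where
  "pos_orthant = {a. \<forall>j. 0 < a $ j}"

definition neg_orthant :: "(real ^ 'n) set" where
  "neg_orthant = {a. \<forall>j. a $ j < 0}"

definition phi :: "real ^ 'n \<Rightarrow> complex ^ 'n \<Rightarrow> ereal" where
  "phi a x = Max (range (\<lambda>k. ereal (inverse (a $ k)) * elog (cmod (x $ k))))"

text \<open>
  Used for \<open>a\<close> in the positive orthant. For \<open>x \<noteq> 0\<close> near \<open>0\<close> the denominator is finite and
  negative, so the quotient is \<open>\<infinity>\<close> where \<open>u x = -\<infinity>\<close>.
\<close>

definition nu :: "(complex ^ 'n \<Rightarrow> ereal) \<Rightarrow> real ^ 'n \<Rightarrow> ereal" where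
  "nu u a = Liminf (at 0) (\<lambda>x. u x / phi a x)"

definition Psi_hat :: "(complex ^ 'n \<Rightarrow> ereal) \<Rightarrow> real ^ 'n \<Rightarrow> ereal" where
  "Psi_hat u t = - nu u (- t)"

definition indicator_diagram :: "(complex ^ 'n \<Rightarrow> ereal) \<Rightarrow> (real ^ 'n) set" where
  "indicator_diagram u =
     {a \<in> closure pos_orthant. \<forall>t\<in>neg_orthant. ereal (a \<bullet> t) \<le> Psi_hat u t}"

end

theory Submission
  imports Defs
begin

text \<open>
  In logarithmic coordinates \<open>g s = u (exp s\<^sub>1, \<dots>, exp s\<^sub>n)\<close> is convex and increasing in every variable near
  \<open>(-\<infinity>, \<dots>, -\<infinity>)\<close>, and \<open>\<Psi>\<close> at \<open>t\<close> is the slope of \<open>g\<close> at infinity along the ray spanned by \<open>t\<close>. Put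
  \<open>\<beta> = \<alpha> + 1\<close>. Since Lebesgue measure becomes \<open>exp (2 \<Sum> s\<^sub>j) ds\<close>, the monomial lies in the multiplier
  ideal iff \<open>exp (2 (\<beta> \<bullet> s - g s))\<close> is integrable near \<open>(-\<infinity>, \<dots>, -\<infinity>)\<close>. Both this integrability and
  \<open>\<beta> \<in> int \<Gamma>\<close> are equivalent to linear growth \<open>g s - \<beta> \<bullet> s \<ge> \<epsilon> \<Sum> \<bar>s\<^sub>j\<bar> - C\<close> for some \<open>\<epsilon> > 0\<close>. The main
  work is the convexity of \<open>g\<close>, because the sub-mean value property is available on complex lines only,
  and their logarithmic images are curved.
\<close>

subsection \<open>Circle means and upper semicontinuity\<close>

text \<open>An affine circle of radius \<rho> follows t only up to an error of order \<rho>^2. To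
  that order the error is a multiple of cos (2 \<theta>), whose mean is zero, so a linear functional
  of it contributes nothing at order \<rho>^2, however large the functional is. This is why g is
  compared with quadratic functions touching it from above, and why only trigonometric majorants of
  degree two are integrated. As g is merely upper semicontinuous and may take the value -infinity,
  convexity is expressed through real numbers c with g s \<le> c. On vectors with negative entries
  the sum of the |s_j| is minus the sum of the s_j. Linear growth is therefore itself a linear lower
  bound, with \<beta> lowered along the diagonal, and so has the same form as the inequality that
  defines \<Gamma>.\<close>

lemma Ln_approx_quadratic:
  fixes z :: complex
  assumes "norm z \<le> 1 / 2"
  shows "norm (Ln (1 + z) - (z - z\<^sup>2 / 2)) \<le> 2 * norm z ^ 3"
proof -
  let ?f = "\<lambda>n. - ((- z) ^ n) / of_nat n"
  have "?f sums Ln (1 + z)"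
    using assms by (intro Ln_series') auto
  from sums_split_initial_segment[OF this, of 3]
  have *: "(\<lambda>i. ?f (i + 3)) sums (Ln (1 + z) - (z - z\<^sup>2 / 2))"
    by (simp add: numeral_eq_Suc algebra_simps power2_eq_square)
  have bd: "norm (?f (i + 3)) \<le> norm z ^ 3 * norm z ^ i" for i
  proof -
    have "norm (?f (i + 3)) = norm z ^ 3 * norm z ^ i / real (i + 3)"
      by (simp add: norm_divide norm_power power_add norm_mult del: of_nat_add)
    also have "\<dots> \<le> norm z ^ 3 * norm z ^ i"
      by (simp add: divide_le_eq mult_le_cancel_left1 not_less del: of_nat_add)
    finally show ?thesis .
  qed
  \<comment> \<open>The ratio is at most 1/2, so the geometric factor is at most 2; this is the
    constant of the bound.\<close>
  have geo: "(\<lambda>i. norm z ^ 3 * norm z ^ i) sums (norm z ^ 3 * (1 / (1 - norm z)))"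
    using assms by (intro sums_mult geometric_sums) auto
  have "norm (Ln (1 + z) - (z - z\<^sup>2 / 2)) \<le> norm z ^ 3 * (1 / (1 - norm z))"
    using norm_suminf_le[of "\<lambda>i. ?f (i + 3)", OF bd sums_summable[OF geo]]
    by (simp only: sums_unique[OF *, symmetric] sums_unique[OF geo, symmetric])
  also have "\<dots> \<le> norm z ^ 3 * 2"
    using assms by (intro mult_left_mono) (auto simp: field_simps)
  finally show ?thesis by simp
qed

text \<open>Real part of the expansion at y e^(i \<theta>); De Moivre turns the square into cos (2
  \<theta>). The remainder has to be cubic because the decisive gain later on is quadratic in the
  radius.\<close>

lemma ln_cmod_approx:
  assumes "\<bar>y\<bar> \<le> 1 / 2"
  shows "\<bar>ln (cmod (1 + of_real y * cis \<theta>)) - (y * cos \<theta> - y\<^sup>2 * cos (2 * \<theta>) / 2)\<bar> \<le> 2 * \<bar>y\<bar> ^ 3"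
proof -
  let ?z = "of_real y * cis \<theta>"
  have n: "norm ?z = \<bar>y\<bar>" by (simp add: norm_mult)
  have nz: "1 + ?z \<noteq> 0"
  proof
    assume "1 + ?z = 0"
    hence "?z = -1" by (simp add: add_eq_0_iff)
    hence "norm ?z = 1" by simp
    thus False using n assms by simp
  qed
  have "Re (Ln (1 + ?z) - (?z - ?z\<^sup>2 / 2)) =
      ln (cmod (1 + ?z)) - (y * cos \<theta> - y\<^sup>2 * cos (2 * \<theta>) / 2)"
    using nz by (simp add: power_mult_distrib Complex.DeMoivre Re_divide_numeral del: of_real_power flip: of_real_power)
  then show ?thesis
    using Ln_approx_quadratic[of ?z] n assms abs_Re_le_cmod[of "Ln (1 + ?z) - (?z - ?z\<^sup>2 / 2)"]
    by simp
qed

lemma integral_trigonometric: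
  "((\<lambda>\<theta>. c + A * cos \<theta> + B * cos (2 * \<theta>)) has_integral (2 * pi * c)) {0..2 * pi}"
proof -
  have "((\<lambda>\<theta>. c + A * cos \<theta> + B * cos (2 * \<theta>)) has_integral
      ((\<lambda>\<theta>. c * \<theta> + A * sin \<theta> + B * sin (2 * \<theta>) / 2) (2 * pi) -
       (\<lambda>\<theta>. c * \<theta> + A * sin \<theta> + B * sin (2 * \<theta>) / 2) 0)) {0..2 * pi}"
    by (rule fundamental_theorem_of_calculus)
      (auto intro!: derivative_eq_intros simp flip: has_real_derivative_iff_has_vector_derivative)
  moreover have "sin (4 * pi) = 0"
    using sin_npi[of 4] by simp
  ultimately show ?thesis by (simp add: mult.commute)
qed

text \<open>Positive and negative parts are compared separately with those of the majorant, by
  monotonicity of the nonnegative integral, which holds without measurability. An infinite negative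
  part only lowers the mean.\<close>

lemma circle_mean_le_trigonometric:
  fixes u :: "complex ^ 'n \<Rightarrow> ereal"
  assumes "\<And>\<theta>. u (z + cis \<theta> *s w) \<le> ereal (c + A * cos \<theta> + B * cos (2 * \<theta>))"
  shows "circle_mean u z w \<le> ereal c"
proof -
  let ?U = "\<lambda>\<theta>. c + A * cos \<theta> + B * cos (2 * \<theta>)"
  let ?I = "{0..2 * pi}"
  have cont: "continuous_on ?I ?U" by (intro continuous_intros)
  have i1: "integrable lborel (\<lambda>\<theta>. indicator ?I \<theta> *\<^sub>R max (?U \<theta>) 0)"
   and i2: "integrable lborel (\<lambda>\<theta>. indicator ?I \<theta> *\<^sub>R max (- ?U \<theta>) 0)"
   and i0: "integrable lborel (\<lambda>\<theta>. indicator ?I \<theta> *\<^sub>R ?U \<theta>)"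
    by (intro borel_integrable_compact continuous_intros; simp)+
  let ?P = "LINT \<theta>|lborel. indicator ?I \<theta> *\<^sub>R max (?U \<theta>) 0"
  let ?N = "LINT \<theta>|lborel. indicator ?I \<theta> *\<^sub>R max (- ?U \<theta>) 0"
  have P0: "0 \<le> ?P" by (intro integral_nonneg_AE) auto
  have N0: "0 \<le> ?N" by (intro integral_nonneg_AE) auto
  have PN: "?P - ?N = 2 * pi * c"
  proof -
    have "?P - ?N = (LINT \<theta>|lborel. indicator ?I \<theta> *\<^sub>R ?U \<theta>)"
      by (subst Bochner_Integration.integral_diff[OF i1 i2, symmetric])
        (auto intro!: Bochner_Integration.integral_cong simp: max_def indicator_def)
    also have "\<dots> = integral ?I ?U"
      using i0 by (subst set_borel_integral_eq_integral(2)[symmetric])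
        (auto simp: set_lebesgue_integral_def set_integrable_def)
    also have "\<dots> = 2 * pi * c"
      using integral_trigonometric by (rule integral_unique)
    finally show ?thesis .
  qed
  have "(\<integral>\<^sup>+\<theta>\<in>?I. e2ennreal (u (z + cis \<theta> *s w)) \<partial>lborel) \<le>
      (\<integral>\<^sup>+\<theta>. ennreal (indicator ?I \<theta> *\<^sub>R max (?U \<theta>) 0) \<partial>lborel)"
  proof (rule nn_integral_mono)
    fix \<theta> :: real
    have "e2ennreal (u (z + cis \<theta> *s w)) \<le> e2ennreal (ereal (?U \<theta>))"
      by (rule e2ennreal_mono[OF assms])
    also have "\<dots> = ennreal (max (?U \<theta>) 0)"
      by (simp add: max_def ennreal_neg)
    finally show "e2ennreal (u (z + cis \<theta> *s w)) * indicator ?I \<theta> \<le>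
        ennreal (indicator ?I \<theta> *\<^sub>R max (?U \<theta>) 0)"
      by (auto simp: indicator_def)
  qed
  also have "\<dots> = ennreal ?P"
    by (intro nn_integral_eq_integral i1) auto
  finally have pos: "enn2ereal (\<integral>\<^sup>+\<theta>\<in>?I. e2ennreal (u (z + cis \<theta> *s w)) \<partial>lborel) \<le> ereal ?P"
    using P0 by (simp add: less_eq_ennreal.rep_eq enn2ereal_ennreal)
  have "ennreal ?N = (\<integral>\<^sup>+\<theta>. ennreal (indicator ?I \<theta> *\<^sub>R max (- ?U \<theta>) 0) \<partial>lborel)"
    by (intro nn_integral_eq_integral[symmetric] i2) auto
  also have "\<dots> \<le> (\<integral>\<^sup>+\<theta>\<in>?I. e2ennreal (- u (z + cis \<theta> *s w)) \<partial>lborel)"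
  proof (rule nn_integral_mono)
    fix \<theta> :: real
    have "ennreal (max (- ?U \<theta>) 0) = e2ennreal (ereal (- ?U \<theta>))"
      by (auto simp add: max_def ennreal_neg)
    also have "ereal (- ?U \<theta>) = - ereal (?U \<theta>)" by simp
    also have "e2ennreal (- ereal (?U \<theta>)) \<le> e2ennreal (- u (z + cis \<theta> *s w))"
      by (rule e2ennreal_mono) (simp only: ereal_minus_le_minus assms)
    finally show "ennreal (indicator ?I \<theta> *\<^sub>R max (- ?U \<theta>) 0)
        \<le> e2ennreal (- u (z + cis \<theta> *s w)) * indicator ?I \<theta>"
      by (auto simp: indicator_def)
  qed
  finally have neg: "ereal ?N \<le> enn2ereal (\<integral>\<^sup>+\<theta>\<in>?I. e2ennreal (- u (z + cis \<theta> *s w)) \<partial>lborel)"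
    using N0 by (simp add: less_eq_ennreal.rep_eq enn2ereal_ennreal)
  have "circle_mean u z w \<le> (ereal ?P - ereal ?N) / ereal (2 * pi)"
    unfolding circle_mean_def
    by (intro ereal_divide_right_mono ereal_minus_mono pos neg) auto
  also have "\<dots> = ereal c" using PN by simp
  finally show ?thesis .
qed

text \<open>Without a maximum, every point has a neighbourhood on which f stays below some value f
  y. A finite subcover has a largest such value, taken at a point m of T, and then f m < f
  m.\<close>

lemma usc_attains_max:
  fixes f :: "'a::topological_space \<Rightarrow> ereal"
  assumes "compact T" "T \<noteq> {}" "usc_on T f"
  shows "\<exists>x\<in>T. \<forall>y\<in>T. f y \<le> f x"
proof (rule ccontr)
  assume "\<not> ?thesis"
  then have ex: "\<exists>y\<in>T. f x < f y" if "x \<in> T" for x using that by (meson not_le)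
  let ?C = "{U. open U \<and> (\<exists>y\<in>T. \<forall>v\<in>U \<inter> T. f v < f y)}"
  have cov: "T \<subseteq> \<Union>?C"
  proof
    fix x assume x: "x \<in> T"
    from ex[OF x] obtain y where y: "y \<in> T" "f x < f y" by blast
    with assms(3) x have "\<forall>\<^sub>F v in at x within T. f v < f y" by (auto simp: usc_on_def)
    then obtain U where U: "open U" "x \<in> U" "\<forall>v\<in>U. v \<noteq> x \<longrightarrow> v \<in> T \<longrightarrow> f v < f y"
      by (auto simp: eventually_at_topological)
    with y have "\<forall>v\<in>U \<inter> T. f v < f y" by auto
    with U y show "x \<in> \<Union>?C" by auto
  qed
  obtain D where D: "D \<subseteq> ?C" "finite D" "T \<subseteq> \<Union>D"
    by (rule compactE[OF assms(1) cov]) auto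
  have "\<exists>m\<in>T. \<forall>v\<in>\<Union>D \<inter> T. f v < f m" using D(2,1)
  proof (induction rule: finite_induct)
    case empty
    with assms(2) show ?case by auto
  next
    case (insert U D)
    then obtain m where m: "m \<in> T" "\<forall>v\<in>\<Union>D \<inter> T. f v < f m" by auto
    from insert.prems obtain y where y: "y \<in> T" "\<forall>v\<in>U \<inter> T. f v < f y" by auto
    show ?case
    proof (cases "f y \<le> f m")
      case True
      with m y show ?thesis by (intro bexI[of _ m]) (auto intro: less_le_trans)
    next
      case False
      then have "f m < f y" by simp
      with m y show ?thesis by (intro bexI[of _ y]) (auto intro: less_trans[of _ "f m"])
    qed
  qed
  with D(3) show False by blast
qed

subsection \<open>Logarithmic convexity\<close>

text \<open>
  For \<open>z = exp s\<close> componentwise, \<open>s + logdisc \<tau> \<theta>\<close> is the logarithmic image of the point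
  \<open>(z\<^sub>j + z\<^sub>j \<tau>\<^sub>j e\<^sup>i\<^sup>\<theta>)\<^sub>j\<close>, which runs through a circle on a complex line.
\<close>

definition logdisc :: "real ^ 'n \<Rightarrow> real \<Rightarrow> real ^ 'n" where
  "logdisc \<tau> \<theta> = (\<chi> j. ln (cmod (1 + of_real (\<tau> $ j) * cis \<theta>)))"

text \<open>First-order size of the displacement, used to keep a whole circle inside a given
  neighbourhood of its centre.\<close>

lemma norm_logdisc_le:
  assumes "norm \<tau> \<le> 1 / 2"
  shows "norm (logdisc \<tau> \<theta>) \<le> 2 * real CARD('n) * norm (\<tau> :: real ^ 'n)"
proof -
  have "\<bar>logdisc \<tau> \<theta> $ j\<bar> \<le> 2 * norm \<tau>" for j
  proof -
    have le: "\<bar>\<tau> $ j\<bar> \<le> norm \<tau>" by (rule component_le_norm_cart)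
    with assms have t: "\<bar>\<tau> $ j\<bar> \<le> 1 / 2" by simp
    let ?y = "\<tau> $ j"
    have "\<bar>ln (cmod (1 + of_real ?y * cis \<theta>))\<bar>
        \<le> 2 * \<bar>?y\<bar> ^ 3 + \<bar>?y * cos \<theta>\<bar> + \<bar>?y\<^sup>2 * cos (2 * \<theta>) / 2\<bar>"
      using ln_cmod_approx[OF t, of \<theta>] by linarith
    moreover have "\<bar>?y * cos \<theta>\<bar> \<le> \<bar>?y\<bar>"
      by (simp add: abs_mult mult_left_le)
    moreover have "\<bar>?y\<^sup>2 * cos (2 * \<theta>) / 2\<bar> \<le> \<bar>?y\<bar>\<^sup>2 / 2"
      by (simp add: abs_mult mult_left_le)
    moreover have "\<bar>?y\<bar>\<^sup>2 \<le> \<bar>?y\<bar> * (1 / 2)"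
      unfolding power2_eq_square using t by (intro mult_left_mono) auto
    moreover have "\<bar>?y\<bar> ^ 3 \<le> \<bar>?y\<bar> * (1 / 4)"
      unfolding power3_eq_cube mult.assoc using mult_mono[OF t t] by (intro mult_left_mono) auto
    ultimately have "\<bar>ln (cmod (1 + of_real ?y * cis \<theta>))\<bar> \<le> 2 * \<bar>?y\<bar>" by linarith
    with le show ?thesis by (simp add: logdisc_def)
  qed
  then have "(\<Sum>j\<in>UNIV. \<bar>logdisc \<tau> \<theta> $ j\<bar>) \<le> (\<Sum>j\<in>(UNIV::'n set). 2 * norm \<tau>)"
    by (intro sum_mono)
  with norm_le_l1_cart[of "logdisc \<tau> \<theta>"] show ?thesis by simp
qed

text \<open>The curve leaves the direction t along the vector of the squares of the t_j, with the
  mean-free factor cos (2 \<theta>); everything else is cubic.\<close>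

lemma logdisc_expansion:
  fixes t :: "real ^ 'n"
  assumes "0 \<le> \<rho>" "\<rho> * norm t \<le> 1 / 2"
  shows "norm (logdisc (\<rho> *\<^sub>R t) \<theta> - ((\<rho> * cos \<theta>) *\<^sub>R t - (\<rho>\<^sup>2 * cos (2 * \<theta>) / 2) *\<^sub>R (\<chi> j. (t $ j)\<^sup>2)))
    \<le> 2 * real CARD('n) * (\<rho> * norm t) ^ 3"
proof -
  let ?e = "logdisc (\<rho> *\<^sub>R t) \<theta> - ((\<rho> * cos \<theta>) *\<^sub>R t - (\<rho>\<^sup>2 * cos (2 * \<theta>) / 2) *\<^sub>R (\<chi> j. (t $ j)\<^sup>2))"
  have "\<bar>?e $ j\<bar> \<le> 2 * (\<rho> * norm t) ^ 3" for j
  proof -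
    have le: "\<bar>\<rho> * t $ j\<bar> \<le> \<rho> * norm t"
      using assms(1) by (simp add: abs_mult mult_left_mono component_le_norm_cart)
    have e: "?e $ j = ln (cmod (1 + of_real (\<rho> * t $ j) * cis \<theta>)) -
        ((\<rho> * t $ j) * cos \<theta> - (\<rho> * t $ j)\<^sup>2 * cos (2 * \<theta>) / 2)"
      by (simp add: logdisc_def power_mult_distrib algebra_simps)
    have "\<bar>?e $ j\<bar> \<le> 2 * \<bar>\<rho> * t $ j\<bar> ^ 3"
      unfolding e using le assms(2) by (intro ln_cmod_approx) simp
    also have "\<dots> \<le> 2 * (\<rho> * norm t) ^ 3"
      using le by (intro mult_left_mono power_mono) auto
    finally show ?thesis .
  qed
  then have "(\<Sum>j\<in>UNIV. \<bar>?e $ j\<bar>) \<le> (\<Sum>j\<in>(UNIV::'n set). 2 * (\<rho> * norm t) ^ 3)"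
    by (intro sum_mono)
  with norm_le_l1_cart[of ?e] show ?thesis by simp
qed

text \<open>The left side is the increment of a quadratic test function with gradient p, curvature
  -2 \<eta> along t and 2 K across it. Up to order \<rho>^3 the linear part has mean zero, and the
  part along t has mean -\<eta> \<rho>^2 / 2. Hence c is negative for small \<rho>, whatever p and K
  are.\<close>

lemma quadratic_on_logdisc:
  fixes t p :: "real ^ 'n"
  assumes t: "t \<noteq> 0" and "0 < \<eta>" "0 \<le> K"
  shows "\<exists>r>0. \<forall>\<rho>\<in>{0<..<r}. \<exists>c A B. c < 0 \<and> (\<forall>\<theta>. let v = logdisc (\<rho> *\<^sub>R t) \<theta>; x = (v \<bullet> t) / (t \<bullet> t) in
      p \<bullet> v - \<eta> * x\<^sup>2 + K * (norm (v - x *\<^sub>R t))\<^sup>2 \<le> c + A * cos \<theta> + B * cos (2 * \<theta>))"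
proof -
  define N where "N = norm t"
  define n where "n = real CARD('n)"
  define sq where "sq = (\<chi> j. (t $ j)\<^sup>2)"
  \<comment> \<open>\<open>\<rho>\<^sup>2 * C2\<close> bounds the part of v beyond first order. The
    three summands of C below are the errors made in the linear term, in the square along t and in
    the transversal square.\<close>
  define C2 where "C2 = norm sq / 2 + n * N\<^sup>2"
  define C where "C = 2 * n * N ^ 3 * norm p + 2 * \<eta> * C2 / N + 4 * K * C2\<^sup>2"
  \<comment> \<open>The three bounds serve, in this order, to absorb \<rho>^4 into \<rho>^3, to make
    the expansion valid, and to get C \<rho> < \<eta> / 2.\<close>
  define r where "r = Min {1, 1 / (2 * N), \<eta> / (2 * (C + 1))}"
  have N: "N > 0" using t by (simp add: N_def)
  have tt: "t \<bullet> t = N\<^sup>2" by (simp add: N_def dot_square_norm)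
  have n: "n > 0" by (simp add: n_def)
  have C2: "C2 \<ge> 0" using n by (simp add: C2_def)
  have C: "C \<ge> 0" unfolding C_def using N n assms C2 by (intro add_nonneg_nonneg) auto
  have r0: "r > 0" using N C assms by (simp add: r_def)
  show ?thesis
  proof (rule exI[of _ r], rule conjI[OF r0], rule ballI)
    fix \<rho> assume "\<rho> \<in> {0<..<r}"
    then have \<rho>: "0 < \<rho>" "\<rho> < 1" "\<rho> < 1 / (2 * N)" "\<rho> < \<eta> / (2 * (C + 1))" by (auto simp: r_def)
    have \<rho>N: "\<rho> * N \<le> 1 / 2" using \<rho>(3) N by (simp add: field_simps)
    have C\<rho>: "C * \<rho> < \<eta> / 2"
    proof -
      have "C * \<rho> \<le> (C + 1) * \<rho>" using \<rho> by simp
      also have "\<dots> < \<eta> / 2" using \<rho>(4) C by (simp add: field_simps)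
      finally show ?thesis .
    qed
    \<comment> \<open>The first term is the mean of -\<eta> \<rho>^2 (cos \<theta>)^2, the second
      absorbs all errors. A and B collect the oscillating terms; the last part of B comes from
      writing (cos \<theta>)^2 through cos (2 \<theta>).\<close>
    define c where "c = - (\<eta> * \<rho>\<^sup>2 / 2) + C * \<rho> ^ 3"
    define A where "A = \<rho> * (p \<bullet> t)"
    define B where "B = - (\<rho>\<^sup>2 / 2 * (p \<bullet> sq)) - \<eta> * \<rho>\<^sup>2 / 2"
    have "c = \<rho>\<^sup>2 * (C * \<rho> - \<eta> / 2)" by (simp add: c_def algebra_simps power2_eq_square power3_eq_cube)
    with C\<rho> \<rho> have c: "c < 0" by (simp add: mult_pos_neg)
    have "p \<bullet> v - \<eta> * x\<^sup>2 + K * (norm (v - x *\<^sub>R t))\<^sup>2 \<le> c + A * cos \<theta> + B * cos (2 * \<theta>)"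
      if v: "v = logdisc (\<rho> *\<^sub>R t) \<theta>" and x: "x = (v \<bullet> t) / (t \<bullet> t)" for v x \<theta>
    proof -
      define b where "b = - ((\<rho>\<^sup>2 * cos (2 * \<theta>) / 2) *\<^sub>R sq)"
      define e where "e = v - ((\<rho> * cos \<theta>) *\<^sub>R t + b)"
      define w where "w = b + e"
      define xw where "xw = (w \<bullet> t) / (t \<bullet> t)"
      have e: "norm e \<le> 2 * n * (\<rho> * N) ^ 3"
        using logdisc_expansion[of \<rho> t \<theta>] \<rho>N \<rho>(1)
        by (simp add: e_def b_def sq_def v n_def N_def)
      have vw: "v = (\<rho> * cos \<theta>) *\<^sub>R t + w" by (simp add: w_def e_def)
      have "norm b \<le> \<rho>\<^sup>2 * (norm sq / 2)"
        by (simp add: b_def abs_mult mult_left_le mult_right_mono)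
      moreover have "2 * n * (\<rho> * N) ^ 3 \<le> \<rho>\<^sup>2 * (n * N\<^sup>2)"
      proof -
        have "2 * n * (\<rho> * N) ^ 3 = (\<rho>\<^sup>2 * (n * N\<^sup>2)) * (2 * (\<rho> * N))"
          by (simp add: power2_eq_square power3_eq_cube)
        also have "\<dots> \<le> (\<rho>\<^sup>2 * (n * N\<^sup>2)) * 1"
          using \<rho>N n by (intro mult_left_mono) auto
        finally show ?thesis by simp
      qed
      moreover have "norm w \<le> norm b + norm e" by (simp add: w_def norm_triangle_ineq)
      ultimately have w: "norm w \<le> \<rho>\<^sup>2 * C2" using e by (simp add: C2_def algebra_simps)
      have "\<bar>xw\<bar> = \<bar>w \<bullet> t\<bar> / N\<^sup>2" by (simp add: xw_def tt abs_divide)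
      also have "\<dots> \<le> (norm w * N) / N\<^sup>2"
        by (intro divide_right_mono) (auto simp: N_def Cauchy_Schwarz_ineq2)
      also have "\<dots> = norm w / N" using N by (simp add: power2_eq_square)
      also have "\<dots> \<le> \<rho>\<^sup>2 * C2 / N" using w N by (intro divide_right_mono) auto
      finally have xwb: "\<bar>xw\<bar> \<le> \<rho>\<^sup>2 * C2 / N" .
      have xx: "x = \<rho> * cos \<theta> + xw"
        using t by (simp add: x xw_def vw inner_add_left add_divide_distrib)
      have "\<bar>p \<bullet> e\<bar> \<le> norm p * norm e" by (rule Cauchy_Schwarz_ineq2)
      also have "\<dots> \<le> norm p * (2 * n * (\<rho> * N) ^ 3)" using e by (intro mult_left_mono) auto
      finally have pe: "p \<bullet> e \<le> \<rho> ^ 3 * (2 * n * N ^ 3 * norm p)"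
        by (simp add: power_mult_distrib algebra_simps)
      have "v = (\<rho> * cos \<theta>) *\<^sub>R t + b + e" by (simp add: e_def)
      then have "p \<bullet> v = \<rho> * cos \<theta> * (p \<bullet> t) + p \<bullet> b + p \<bullet> e" by (simp add: inner_add_right)
      also have "p \<bullet> b = - (\<rho>\<^sup>2 / 2 * (p \<bullet> sq) * cos (2 * \<theta>))" by (simp add: b_def)
      finally have pv: "p \<bullet> v \<le> A * cos \<theta> - \<rho>\<^sup>2 / 2 * (p \<bullet> sq) * cos (2 * \<theta>) + \<rho> ^ 3 * (2 * n * N ^ 3 * norm p)"
        using pe by (simp add: A_def algebra_simps)
      have "- (\<rho> * cos \<theta> * xw) \<le> \<bar>\<rho> * cos \<theta> * xw\<bar>" by simp
      also have "\<dots> = \<rho> * (\<bar>cos \<theta>\<bar> * \<bar>xw\<bar>)" using \<rho> by (simp add: abs_mult)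
      also have "\<dots> \<le> \<rho> * (1 * (\<rho>\<^sup>2 * C2 / N))"
        using \<rho> xwb by (intro mult_left_mono mult_mono) auto
      also have "\<dots> = \<rho> ^ 3 * (C2 / N)" by (simp add: power2_eq_square power3_eq_cube)
      finally have "- (\<rho> * cos \<theta> * xw) \<le> \<rho> ^ 3 * (C2 / N)" .
      moreover have "x\<^sup>2 = \<rho>\<^sup>2 * (cos \<theta>)\<^sup>2 + 2 * (\<rho> * cos \<theta> * xw) + xw\<^sup>2"
        unfolding xx by (simp add: power2_eq_square algebra_simps)
      moreover have "xw\<^sup>2 \<ge> 0" by simp
      ultimately have "- x\<^sup>2 \<le> - (\<rho>\<^sup>2 * (cos \<theta>)\<^sup>2) + 2 * (\<rho> ^ 3 * (C2 / N))" by linarith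
      moreover have "(cos \<theta>)\<^sup>2 = (1 + cos (2 * \<theta>)) / 2" using cos_double_cos[of \<theta>] by simp
      ultimately have "- x\<^sup>2 \<le> - (\<rho>\<^sup>2 * ((1 + cos (2 * \<theta>)) / 2)) + 2 * (\<rho> ^ 3 * (C2 / N))" by simp
      from mult_left_mono[OF this, of \<eta>] assms(2)
      have xv: "- (\<eta> * x\<^sup>2) \<le> - (\<eta> * \<rho>\<^sup>2 / 2) - \<eta> * \<rho>\<^sup>2 / 2 * cos (2 * \<theta>) + \<rho> ^ 3 * (2 * \<eta> * C2 / N)"
        by (simp add: algebra_simps add_divide_distrib)
      have "v - x *\<^sub>R t = w - xw *\<^sub>R t" by (simp add: vw xx algebra_simps)
      then have "norm (v - x *\<^sub>R t) \<le> norm w + \<bar>xw\<bar> * N"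
        using norm_triangle_ineq4[of w "xw *\<^sub>R t"] by (simp add: N_def)
      also have "\<bar>xw\<bar> * N \<le> \<rho>\<^sup>2 * C2 / N * N" using xwb N by (intro mult_right_mono) auto
      also have "\<dots> = \<rho>\<^sup>2 * C2" using N by simp
      finally have "norm (v - x *\<^sub>R t) \<le> 2 * \<rho>\<^sup>2 * C2" using w by simp
      then have "(norm (v - x *\<^sub>R t))\<^sup>2 \<le> (2 * \<rho>\<^sup>2 * C2)\<^sup>2" by (intro power_mono) auto
      also have "\<dots> = 4 * C2\<^sup>2 * \<rho> ^ 3 * \<rho>" by (simp add: power2_eq_square power3_eq_cube)
      also have "\<dots> \<le> 4 * C2\<^sup>2 * \<rho> ^ 3 * 1" using \<rho> by (intro mult_left_mono) auto
      finally have "K * (norm (v - x *\<^sub>R t))\<^sup>2 \<le> K * (4 * C2\<^sup>2 * \<rho> ^ 3)"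
        using assms(3) by (intro mult_left_mono) auto
      then have yv: "K * (norm (v - x *\<^sub>R t))\<^sup>2 \<le> \<rho> ^ 3 * (4 * K * C2\<^sup>2)" by (simp add: mult_ac)
      have "c + A * cos \<theta> + B * cos (2 * \<theta>) = (A * cos \<theta> - \<rho>\<^sup>2 / 2 * (p \<bullet> sq) * cos (2 * \<theta>) + \<rho> ^ 3 * (2 * n * N ^ 3 * norm p))
         + (- (\<eta> * \<rho>\<^sup>2 / 2) - \<eta> * \<rho>\<^sup>2 / 2 * cos (2 * \<theta>) + \<rho> ^ 3 * (2 * \<eta> * C2 / N))
         + \<rho> ^ 3 * (4 * K * C2\<^sup>2)"
        unfolding c_def B_def C_def by (simp add: ring_distribs mult_ac)
      with pv xv yv show ?thesis by linarith
    qed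
    with c show "\<exists>c A B. c < 0 \<and> (\<forall>\<theta>. let v = logdisc (\<rho> *\<^sub>R t) \<theta>; x = (v \<bullet> t) / (t \<bullet> t) in
      p \<bullet> v - \<eta> * x\<^sup>2 + K * (norm (v - x *\<^sub>R t))\<^sup>2 \<le> c + A * cos \<theta> + B * cos (2 * \<theta>))"
      unfolding Let_def by (intro exI[of _ c] exI[of _ A] exI[of _ B]) simp
  qed
qed

lemma usc_on_minus_continuous:
  fixes g :: "'a::topological_space \<Rightarrow> ereal"
  assumes g: "usc_on T g" "\<And>s. s \<in> T \<Longrightarrow> g s < \<infinity>" and q: "continuous_on T q"
  shows "usc_on T (\<lambda>s. g s - ereal (q s))"
  unfolding usc_on_def
proof (intro ballI allI impI)
  fix z c assume z: "z \<in> T" and c: "g z - ereal (q z) < c"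
  have tq: "(q \<longlongrightarrow> q z) (at z within T)" using q z by (simp add: continuous_on_def)
  show "\<forall>\<^sub>F s in at z within T. g s - ereal (q s) < c"
  proof (cases c)
    case (real r)
    then have "g z < ereal (r + q z)" using c by (simp add: ereal_minus_less)
    from ereal_dense2[OF this] obtain b where b: "g z < ereal b" "b < r + q z" by auto
    have "\<forall>\<^sub>F s in at z within T. g s < ereal b" using g(1) z b by (auto simp: usc_on_def)
    moreover have "\<forall>\<^sub>F s in at z within T. b - r < q s"
      by (rule order_tendstoD(1)[OF tq]) (use b in simp)
    ultimately show ?thesis
    proof eventually_elim
      case (elim s)
      then have "g s < ereal (r + q s)"
        by (intro less_trans[OF elim(1)]) simp
      then show ?case using real by (simp add: ereal_minus_less)
    qed
  next
    case PInf
    have "\<forall>\<^sub>F s in at z within T. s \<in> T" by (simp add: eventually_at_filter)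
    then show ?thesis
    proof eventually_elim
      case (elim s)
      then show ?case using g(2)[of s] PInf by (cases "g s") auto
    qed
  next
    case MInf
    with c show ?thesis by simp
  qed
qed

text \<open>
  A viscosity argument. If convexity fails along the segment, then \<open>g\<close> minus the test function
  \<open>q\<close> (affine plus \<open>\<eta> x (1 - x)\<close> along the segment, plus \<open>K\<close> times the squared distance to its line)
  has an interior maximum \<open>z\<close> over a thin tube. There \<open>g\<close> is touched from above by a translate of \<open>q\<close>, whose mean over
  \<open>z + logdisc (\<rho> t)\<close> is smaller than \<open>q z\<close> by order \<open>\<eta> \<rho>\<^sup>2\<close>, because \<open>logdisc (\<rho> t)\<close> leaves the direction \<open>t\<close>
  only to second order, so that the term with \<open>K\<close> contributes \<open>\<rho>\<^sup>4\<close>.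
\<close>

lemma convex_combination_le_of_sub_mean:
  fixes g :: "real ^ 'n \<Rightarrow> ereal"
  assumes D: "open D" "convex D" and usc: "usc_on D g" and fin: "\<And>s. s \<in> D \<Longrightarrow> g s < \<infinity>"
    and sub: "\<And>s t. s \<in> D \<Longrightarrow> \<exists>r>0. \<forall>\<rho>\<in>{0<..<r}. \<forall>c A B.
      (\<forall>\<theta>. g (s + logdisc (\<rho> *\<^sub>R t) \<theta>) \<le> ereal (c + A * cos \<theta> + B * cos (2 * \<theta>))) \<longrightarrow> g s \<le> ereal c"
    and s: "s0 \<in> D" "s1 \<in> D" and c: "g s0 < ereal c0" "g s1 < ereal c1" and l: "0 < l" "l < 1"
    and nt: "s0 \<noteq> s1"
  shows "g (s0 + l *\<^sub>R (s1 - s0)) \<le> ereal (c0 + l * (c1 - c0))"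
proof (rule ccontr)
  assume "\<not> ?thesis"
  then have "ereal (c0 + l * (c1 - c0)) < g (s0 + l *\<^sub>R (s1 - s0))" by simp
  from ereal_dense2[OF this] obtain m
    where m: "c0 + l * (c1 - c0) < m" "ereal m < g (s0 + l *\<^sub>R (s1 - s0))" by auto
  define t where "t = s1 - s0"
  \<comment> \<open>Chosen so that \<open>q0\<close> has the value m at parameter l, where g is
    larger than m; the concave bump vanishes at both end points.\<close>
  define \<eta> where "\<eta> = (m - (c0 + l * (c1 - c0))) / (l * (1 - l))"
  define x where "x = (\<lambda>s. ((s - s0) \<bullet> t) / (t \<bullet> t))"
  define y where "y = (\<lambda>s. s - s0 - x s *\<^sub>R t)"
  define q0 where "q0 = (\<lambda>s. c0 + (c1 - c0) * x s + \<eta> * (x s * (1 - x s)))"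
  have t: "t \<noteq> 0" using nt by (simp add: t_def)
  have \<eta>: "\<eta> > 0" using m l by (simp add: \<eta>_def)
  have cx: "continuous_on UNIV x" unfolding x_def using t by (intro continuous_intros) auto
  have cy: "continuous_on UNIV y" unfolding y_def by (intro continuous_intros cx)
  have cq0: "continuous_on UNIV q0" unfolding q0_def by (intro continuous_intros cx)
  have s_eq: "s = s0 + x s *\<^sub>R t + y s" for s by (simp add: y_def)
  let ?sl = "s0 + l *\<^sub>R (s1 - s0)"
  have x_sl: "x ?sl = l" using t by (simp add: x_def t_def)
  have y_sl: "y ?sl = 0" unfolding y_def x_sl by (simp add: t_def)
  have q0_sl: "q0 ?sl = m" unfolding q0_def x_sl using l by (simp add: \<eta>_def)
  have near: "\<exists>\<delta>>0. \<forall>s\<in>D. dist s a < \<delta> \<longrightarrow> g s < ereal c" if "a \<in> D" "g a < ereal c" for a c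
  proof -
    have "\<forall>\<^sub>F s in at a within D. g s < ereal c" using usc that by (auto simp: usc_on_def)
    then obtain d where "d > 0" "\<forall>s\<in>D. s \<noteq> a \<and> dist s a < d \<longrightarrow> g s < ereal c"
      by (auto simp: eventually_at)
    with that show ?thesis by (intro exI[of _ d]) auto
  qed
  obtain \<delta>0 where \<delta>0: "\<delta>0 > 0" "\<And>s. s \<in> D \<Longrightarrow> dist s s0 < \<delta>0 \<Longrightarrow> g s < ereal c0"
    using near[OF s(1) c(1)] by blast
  obtain \<delta>1 where \<delta>1: "\<delta>1 > 0" "\<And>s. s \<in> D \<Longrightarrow> dist s s1 < \<delta>1 \<Longrightarrow> g s < ereal c1"
    using near[OF s(2) c(2)] by blast
  have "closed_segment s0 s1 \<subseteq> D" using D s by (simp add: closed_segment_subset)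
  then obtain \<delta>2 where \<delta>2: "\<delta>2 > 0" "(\<Union>a\<in>closed_segment s0 s1. ball a \<delta>2) \<subseteq> D"
    using compact_subset_open_imp_ball_epsilon_subset[OF compact_segment D(1)] by metis
  \<comment> \<open>The tube of this radius lies in D, and on its two end faces g is still below c0
    and c1 respectively.\<close>
  define \<delta> where "\<delta> = Min {\<delta>0, \<delta>1, \<delta>2} / 2"
  have \<delta>: "\<delta> > 0" "\<delta> < \<delta>0" "\<delta> < \<delta>1" "\<delta> < \<delta>2" using \<delta>0(1) \<delta>1(1) \<delta>2(1) by (auto simp: \<delta>_def)
  define T where "T = {s. 0 \<le> x s \<and> x s \<le> 1 \<and> norm (y s) \<le> \<delta>}"
  have TD: "T \<subseteq> D"
  proof
    fix s assume "s \<in> T"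
    then have xs: "0 \<le> x s" "x s \<le> 1" "norm (y s) < \<delta>2" using \<delta> by (auto simp: T_def)
    have "s0 + x s *\<^sub>R t \<in> closed_segment s0 s1"
      using xs by (auto simp: in_segment t_def algebra_simps intro!: exI[of _ "x s"])
    moreover have "dist (s0 + x s *\<^sub>R t) s < \<delta>2"
      using xs s_eq[of s] by (metis add_diff_cancel_left' dist_commute dist_norm)
    ultimately have "s \<in> (\<Union>a\<in>closed_segment s0 s1. ball a \<delta>2)"
      by (intro UN_I[of "s0 + x s *\<^sub>R t"]) auto
    with \<delta>2(2) show "s \<in> D" by blast
  qed
  have slT: "?sl \<in> T" using l \<delta> by (simp add: T_def x_sl y_sl)
  have "closed T"
    unfolding T_def by (intro closed_Collect_conj closed_Collect_le continuous_intros cx cy)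
  moreover have "bounded T"
  proof (rule boundedI)
    fix s assume "s \<in> T"
    then have xs: "0 \<le> x s" "x s \<le> 1" "norm (y s) \<le> \<delta>" by (auto simp: T_def)
    have "norm s \<le> norm s0 + norm (x s *\<^sub>R t) + norm (y s)"
      by (subst s_eq[of s]) (meson norm_triangle_ineq norm_triangle_le add_right_mono order_trans)
    also have "norm (x s *\<^sub>R t) \<le> norm t" using xs by (simp add: mult_left_le_one_le)
    finally show "norm s \<le> norm s0 + norm t + \<delta>" using xs by simp
  qed
  ultimately have cT: "compact T" by (simp add: compact_eq_bounded_closed)
  have uscT: "usc_on T g"
    using usc TD unfolding usc_on_def by (blast intro: filter_leD[OF at_le[OF TD]])
  obtain s' where s': "s' \<in> T" "\<And>s. s \<in> T \<Longrightarrow> g s \<le> g s'"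
    using usc_attains_max[OF cT _ uscT] slT by blast
  obtain M where M: "g s' \<le> ereal M"
    using fin[of s'] s' TD by (cases "g s'") auto
  have gM: "g s \<le> ereal M" if "s \<in> T" for s using s'(2)[OF that] M by (rule order_trans)
  \<comment> \<open>Large enough that q exceeds the upper bound M of g on the lateral boundary of
    the tube.\<close>
  define K where "K = (\<bar>M\<bar> + \<bar>c0\<bar> + \<bar>c1\<bar> + 1) / \<delta>\<^sup>2"
  have K: "K \<ge> 0" "K * \<delta>\<^sup>2 = \<bar>M\<bar> + \<bar>c0\<bar> + \<bar>c1\<bar> + 1" using \<delta> by (auto simp: K_def)
  define q where "q = (\<lambda>s. q0 s + K * (norm (y s))\<^sup>2)"
  have q_ge: "q0 s \<le> q s" for s using K by (simp add: q_def)
  have cq: "continuous_on UNIV q" unfolding q_def by (intro continuous_intros cq0 cy)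
  have uscf: "usc_on T (\<lambda>s. g s - ereal (q s))"
    using uscT TD fin cq by (intro usc_on_minus_continuous) (auto intro: continuous_on_subset)
  obtain z where z: "z \<in> T" "\<And>s. s \<in> T \<Longrightarrow> g s - ereal (q s) \<le> g z - ereal (q z)"
    using usc_attains_max[OF cT _ uscf] slT by blast
  have "q ?sl = m" by (simp add: q_def y_sl q0_sl)
  with m(2) have "0 < g ?sl - ereal (q ?sl)" by (simp add: ereal_less_minus)
  also note z(2)[OF slT]
  finally have gz: "ereal (q z) < g z" by (simp add: ereal_less_minus)
  then obtain G where G: "g z = ereal G" "q z < G" using gM[OF z(1)] by (cases "g z") auto
  have le: "g s \<le> ereal (q s + (G - q z))" if "s \<in> T" for s
    using z(2)[OF that] G by (cases "g s") auto
  have zD: "z \<in> D" using z TD by auto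
  \<comment> \<open>On the end faces and on the lateral boundary g is below q, whereas g exceeds q
    at z; so z is an interior point of the tube.\<close>
  have "x z \<noteq> 0"
  proof
    assume x0: "x z = 0"
    have "dist z s0 \<le> \<delta>" using z(1) by (simp add: T_def y_def x0 dist_norm)
    then have "g z < ereal c0" using \<delta> zD by (intro \<delta>0(2)) auto
    also have "c0 \<le> q z" using q_ge[of z] by (simp add: q0_def x0)
    finally show False using gz by simp
  qed
  moreover have "x z \<noteq> 1"
  proof
    assume x0: "x z = 1"
    have "dist z s1 \<le> \<delta>" using z(1) by (simp add: T_def y_def x0 dist_norm t_def)
    then have "g z < ereal c1" using \<delta> zD by (intro \<delta>1(2)) auto
    also have "c1 \<le> q z" using q_ge[of z] by (simp add: q0_def x0)
    finally show False using gz by simp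
  qed
  moreover have "norm (y z) \<noteq> \<delta>"
  proof
    assume y: "norm (y z) = \<delta>"
    have xz: "0 \<le> x z" "x z \<le> 1" using z(1) by (auto simp: T_def)
    have "\<bar>c0 * (1 - x z)\<bar> \<le> \<bar>c0\<bar>" "\<bar>c1 * x z\<bar> \<le> \<bar>c1\<bar>"
      using xz by (simp_all add: abs_mult mult_left_le)
    moreover have "q0 z = c0 * (1 - x z) + c1 * x z + \<eta> * (x z * (1 - x z))"
      by (simp add: q0_def algebra_simps)
    moreover have "0 \<le> \<eta> * (x z * (1 - x z))" using \<eta> xz by simp
    moreover have "q z = q0 z + K * \<delta>\<^sup>2" by (simp add: q_def y)
    ultimately have "M < q z" using K(2) by linarith
    then have "ereal M < g z" by (intro less_trans[OF _ gz]) simp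
    with gM[OF z(1)] show False by simp
  qed
  ultimately have zin: "0 < x z" "x z < 1" "norm (y z) < \<delta>" using z(1) by (auto simp: T_def)
  have op: "open {s. 0 < x s \<and> x s < 1 \<and> norm (y s) < \<delta>}"
    by (intro open_Collect_conj open_Collect_less continuous_intros cx cy)
  obtain \<epsilon> where \<epsilon>: "\<epsilon> > 0" "ball z \<epsilon> \<subseteq> {s. 0 < x s \<and> x s < 1 \<and> norm (y s) < \<delta>}"
    by (rule openE[OF op, of z]) (use zin in auto)
  have nearT: "z + v \<in> T" if "norm v < \<epsilon>" for v
  proof -
    have "z + v \<in> ball z \<epsilon>" using that by (simp add: dist_norm)
    with \<epsilon> show ?thesis by (force simp: T_def)
  qed
  \<comment> \<open>The gradient of q at z. As q is quadratic, its expansion about z in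
    \<open>q_plus\<close> is exact.\<close>
  define p where "p = ((c1 - c0 + \<eta> * (1 - 2 * x z)) / (t \<bullet> t)) *\<^sub>R t + (2 * K) *\<^sub>R y z"
  have yt: "y z \<bullet> t = 0" using t by (simp add: y_def x_def inner_diff_left)
  have q_plus: "q (z + v) = q z + (p \<bullet> v - \<eta> * xv\<^sup>2 + K * (norm (v - xv *\<^sub>R t))\<^sup>2)"
    if xv: "xv = (v \<bullet> t) / (t \<bullet> t)" for v xv
  proof -
    have 1: "x (z + v) = x z + xv"
      by (simp add: x_def xv inner_diff_left inner_add_left add_divide_distrib diff_divide_distrib)
    have "y (z + v) = y z + (v - xv *\<^sub>R t)" unfolding y_def 1 by (simp add: algebra_simps)
    then have "(norm (y (z + v)))\<^sup>2 = (norm (y z))\<^sup>2 + 2 * (y z \<bullet> (v - xv *\<^sub>R t)) + (norm (v - xv *\<^sub>R t))\<^sup>2"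
      by (simp add: power2_norm_eq_inner inner_add_left inner_add_right inner_commute)
    also have "y z \<bullet> (v - xv *\<^sub>R t) = y z \<bullet> v" by (simp add: inner_diff_right yt)
    finally have 2: "(norm (y (z + v)))\<^sup>2 = (norm (y z))\<^sup>2 + 2 * (y z \<bullet> v) + (norm (v - xv *\<^sub>R t))\<^sup>2" .
    have 3: "p \<bullet> v = (c1 - c0 + \<eta> * (1 - 2 * x z)) * xv + 2 * K * (y z \<bullet> v)"
      unfolding p_def inner_add_left inner_scaleR_left by (simp add: xv inner_commute)
    show ?thesis unfolding q_def q0_def 1 2 3
      by (simp add: algebra_simps power2_eq_square)
  qed
  from quadratic_on_logdisc[OF t \<eta> K(1), of p] obtain r1 where r1: "r1 > 0"
    "\<forall>\<rho>\<in>{0<..<r1}. \<exists>c A B. c < 0 \<and> (\<forall>\<theta>. let v = logdisc (\<rho> *\<^sub>R t) \<theta>; x = (v \<bullet> t) / (t \<bullet> t) in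
      p \<bullet> v - \<eta> * x\<^sup>2 + K * (norm (v - x *\<^sub>R t))\<^sup>2 \<le> c + A * cos \<theta> + B * cos (2 * \<theta>))"
    by (elim exE conjE) (rule that)
  from sub[OF zD, of t] obtain r2 where r2: "r2 > 0" "\<forall>\<rho>\<in>{0<..<r2}. \<forall>c A B.
      (\<forall>\<theta>. g (z + logdisc (\<rho> *\<^sub>R t) \<theta>) \<le> ereal (c + A * cos \<theta> + B * cos (2 * \<theta>))) \<longrightarrow> g z \<le> ereal c"
    by (elim exE conjE) (rule that)
  define R where "R = Min {r1, r2, 1 / (2 * norm t), \<epsilon> / (2 * real CARD('n) * norm t)}"
  define \<rho> where "\<rho> = R / 2"
  have "0 < R" using r1(1) r2(1) t \<epsilon>(1) by (simp add: R_def)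
  then have \<rho>0: "\<rho> > 0" "\<rho> < R" by (auto simp: \<rho>_def)
  then have \<rho>: "\<rho> < r1" "\<rho> < r2" "\<rho> < 1 / (2 * norm t)" "\<rho> < \<epsilon> / (2 * real CARD('n) * norm t)"
    by (auto simp: R_def)
  have small: "norm (logdisc (\<rho> *\<^sub>R t) \<theta>) < \<epsilon>" for \<theta>
  proof -
    have "norm (\<rho> *\<^sub>R t) \<le> 1 / 2" using \<rho>(3) \<rho>0 t by (simp add: field_simps)
    from norm_logdisc_le[OF this, of \<theta>] \<rho>0
    have "norm (logdisc (\<rho> *\<^sub>R t) \<theta>) \<le> \<rho> * (2 * real CARD('n) * norm t)" by (simp add: mult_ac)
    also have "\<dots> < \<epsilon>" using \<rho>(4) t by (simp add: pos_less_divide_eq)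
    finally show ?thesis .
  qed
  have \<rho>in: "\<rho> \<in> {0<..<r1}" "\<rho> \<in> {0<..<r2}" using \<rho> \<rho>0 by auto
  from bspec[OF r1(2) \<rho>in(1)] obtain c' A B where cAB: "c' < 0"
    "\<forall>\<theta>. let v = logdisc (\<rho> *\<^sub>R t) \<theta>; x = (v \<bullet> t) / (t \<bullet> t) in
      p \<bullet> v - \<eta> * x\<^sup>2 + K * (norm (v - x *\<^sub>R t))\<^sup>2 \<le> c' + A * cos \<theta> + B * cos (2 * \<theta>)"
    by (elim exE conjE) (rule that)
  have "g z \<le> ereal (G + c')"
  proof -
    have "(\<forall>\<theta>. g (z + logdisc (\<rho> *\<^sub>R t) \<theta>) \<le> ereal (G + c' + A * cos \<theta> + B * cos (2 * \<theta>))) \<longrightarrow>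
        g z \<le> ereal (G + c')"
      using bspec[OF r2(2) \<rho>in(2)] by (elim allE)
    moreover
    have "\<forall>\<theta>. g (z + logdisc (\<rho> *\<^sub>R t) \<theta>) \<le> ereal (G + c' + A * cos \<theta> + B * cos (2 * \<theta>))"
    proof
      fix \<theta>
      have "g (z + logdisc (\<rho> *\<^sub>R t) \<theta>) \<le> ereal (q (z + logdisc (\<rho> *\<^sub>R t) \<theta>) + (G - q z))"
        by (intro le nearT small)
      also have "q (z + logdisc (\<rho> *\<^sub>R t) \<theta>) + (G - q z) \<le> G + c' + A * cos \<theta> + B * cos (2 * \<theta>)"
        unfolding q_plus[OF refl] using spec[OF cAB(2), of \<theta>] by (simp add: Let_def)
      finally show "g (z + logdisc (\<rho> *\<^sub>R t) \<theta>) \<le> ereal (G + c' + A * cos \<theta> + B * cos (2 * \<theta>))" by simp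
    qed
    ultimately show ?thesis by (rule mp)
  qed
  with G cAB(1) show False by simp
qed

text \<open>Only real heights c occur, so convexity of a function with value -infinity can be stated
  as convexity of a set in a real vector space.\<close>

definition epigraph_on :: "'a set \<Rightarrow> ('a \<Rightarrow> ereal) \<Rightarrow> ('a \<times> real) set" where
  "epigraph_on D g = {(s, c). s \<in> D \<and> g s \<le> ereal c}"

lemma convex_epigraph_on:
  fixes g :: "real ^ 'n \<Rightarrow> ereal"
  assumes D: "open D" "convex D" and usc: "usc_on D g" and fin: "\<And>s. s \<in> D \<Longrightarrow> g s < \<infinity>"
    and sub: "\<And>s t. s \<in> D \<Longrightarrow> \<exists>r>0. \<forall>\<rho>\<in>{0<..<r}. \<forall>c A B.
      (\<forall>\<theta>. g (s + logdisc (\<rho> *\<^sub>R t) \<theta>) \<le> ereal (c + A * cos \<theta> + B * cos (2 * \<theta>))) \<longrightarrow> g s \<le> ereal c"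
  shows "convex (epigraph_on D g)"
  unfolding convex_alt
proof (intro ballI allI impI)
  fix P Q l assume PQ: "P \<in> epigraph_on D g" "Q \<in> epigraph_on D g" and l: "0 \<le> l \<and> l \<le> (1::real)"
  obtain s0 c0 s1 c1 where P: "P = (s0, c0)" and Q: "Q = (s1, c1)" by (metis surj_pair)
  have s: "s0 \<in> D" "s1 \<in> D" and c: "g s0 \<le> ereal c0" "g s1 \<le> ereal c1"
    using PQ by (auto simp: epigraph_on_def P Q)
  have "g ((1 - l) *\<^sub>R s0 + l *\<^sub>R s1) \<le> ereal ((1 - l) * c0 + l * c1)"
  proof (cases "l = 0 \<or> l = 1 \<or> s0 = s1")
    case True
    then consider "l = 0" | "l = 1" | "s0 = s1" by blast
    then show ?thesis
    proof cases
      case 3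
      have "g s0 \<le> ereal (min c0 c1)" using c 3 by (simp add: min_def)
      moreover have "min c0 c1 \<le> (1 - l) * c0 + l * c1"
      proof -
        have "min c0 c1 = (1 - l) * min c0 c1 + l * min c0 c1" by (simp add: algebra_simps)
        also have "\<dots> \<le> (1 - l) * c0 + l * c1"
          using l by (intro add_mono mult_left_mono) auto
        finally show ?thesis .
      qed
      ultimately have "g s0 \<le> ereal ((1 - l) * c0 + l * c1)"
        by (meson ereal_less_eq(3) order_trans)
      with 3 show ?thesis by (simp flip: scaleR_add_left)
    qed (use c in auto)
  next
    case False
    with l have l: "0 < l" "l < 1" and ne: "s0 \<noteq> s1" by auto
    \<comment> \<open>The viscosity argument asks for strict majorants at the end points; both are
      raised by e, and e then tends to 0.\<close>
    have "g (s0 + l *\<^sub>R (s1 - s0)) \<le> ereal (c0 + l * (c1 - c0)) + ereal e" if "e > 0" for e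
    proof -
      have "g s0 < ereal (c0 + e)" "g s1 < ereal (c1 + e)"
        using c that by (auto intro: le_less_trans)
      from convex_combination_le_of_sub_mean[OF D usc fin sub s this l ne]
      have "g (s0 + l *\<^sub>R (s1 - s0)) \<le> ereal (c0 + e + l * (c1 + e - (c0 + e)))" .
      also have "c0 + e + l * (c1 + e - (c0 + e)) = c0 + l * (c1 - c0) + e" by simp
      finally show ?thesis by simp
    qed
    then have "g (s0 + l *\<^sub>R (s1 - s0)) \<le> ereal (c0 + l * (c1 - c0))"
      by (rule ereal_le_epsilon2)
    also have "s0 + l *\<^sub>R (s1 - s0) = (1 - l) *\<^sub>R s0 + l *\<^sub>R s1" by (simp add: algebra_simps)
    also have "c0 + l * (c1 - c0) = (1 - l) * c0 + l * c1" by (simp add: algebra_simps)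
    finally show ?thesis .
  qed
  moreover have "(1 - l) *\<^sub>R s0 + l *\<^sub>R s1 \<in> D"
    using D(2) s l by (simp add: convex_alt)
  ultimately show "(1 - l) *\<^sub>R P + l *\<^sub>R Q \<in> epigraph_on D g"
    by (simp add: P Q epigraph_on_def)
qed

section \<open>The function \<open>u\<close> on a polydisc, in logarithmic coordinates\<close>

definition expvec :: "real ^ 'n \<Rightarrow> complex ^ 'n" where
  "expvec s = (\<chi> j. of_real (exp (s $ j)))"

lemma continuous_on_expvec: "continuous_on S expvec"
  unfolding expvec_def by (intro continuous_intros)

text \<open>The germ conditions are made to hold on one polydisc. With its radius written as exp L,
  its logarithmic image is a translated negative orthant, convex and closed downwards; the bound M
  is what forces monotonicity there.\<close>

locale multicircled_psh =
  fixes u :: "complex ^ 'n \<Rightarrow> ereal" and \<Omega> :: "(complex ^ 'n) set" and L M :: real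
  assumes psh: "psh_on \<Omega> u"
    and polydisc: "\<And>z. (\<And>j. cmod (z $ j) < exp L) \<Longrightarrow> z \<in> \<Omega>"
    and circled: "\<And>z. (\<And>j. cmod (z $ j) < exp L) \<Longrightarrow> u z = u (\<chi> j. of_real (cmod (z $ j)))"
    and bounded: "\<And>z. (\<And>j. cmod (z $ j) < exp L) \<Longrightarrow> u z \<le> ereal M"
begin

definition D :: "(real ^ 'n) set" where "D = {s. \<forall>j. s $ j < L}"

definition g :: "real ^ 'n \<Rightarrow> ereal" where "g s = u (expvec s)"

lemma open_D: "open D"
proof -
  have "D = (\<Inter>j. {s. s $ j < L})" by (auto simp: D_def)
  then show ?thesis by (auto intro!: open_INT open_Collect_less continuous_intros)
qed

lemma convex_D: "convex D"
  unfolding D_def convex_alt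
  by (auto intro!: convex_bound_lt)

lemma expvec_polydisc: "s \<in> D \<Longrightarrow> cmod (expvec s $ j) < exp L"
  by (simp add: D_def expvec_def)

lemma g_le: "s \<in> D \<Longrightarrow> g s \<le> ereal M"
  unfolding g_def by (intro bounded expvec_polydisc)

lemma u_eq_g:
  assumes "\<And>j. z $ j \<noteq> 0" "\<And>j. cmod (z $ j) < exp L"
  shows "u z = g (\<chi> j. ln (cmod (z $ j)))"
  using circled[OF assms(2)] assms(1) by (simp add: g_def expvec_def)

lemma usc_g: "usc_on D g"
  unfolding usc_on_def
proof (intro ballI allI impI)
  fix s c assume s: "s \<in> D" and c: "g s < c"
  have "expvec s \<in> \<Omega>" by (intro polydisc expvec_polydisc s)
  with psh c have "\<forall>\<^sub>F y in at (expvec s) within \<Omega>. u y < c"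
    by (auto simp: psh_on_def usc_on_def g_def)
  then obtain U where U: "open U" "expvec s \<in> U" "\<And>y. y \<in> U \<Longrightarrow> y \<noteq> expvec s \<Longrightarrow> y \<in> \<Omega> \<Longrightarrow> u y < c"
    by (auto simp: eventually_at_topological)
  have U': "u y < c" if "y \<in> U" "y \<in> \<Omega>" for y
    using U(3)[OF that(1)] that(2) c by (cases "y = expvec s") (auto simp: g_def)
  have "open (expvec -` U)" using U(1) continuous_on_expvec by (rule open_vimage)
  with U(2) U' polydisc expvec_polydisc show "\<forall>\<^sub>F y in at s within D. g y < c"
    unfolding eventually_at_topological g_def by (intro exI[of _ "expvec -` U"]) auto
qed

text \<open>The sub-mean inequality for u at \<open>expvec s\<close> in the direction w with entries
  \<rho> t_j exp (s_j). Since u depends on moduli only, its values on that circle are those of g on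
  s + \<open>logdisc\<close>.\<close>

lemma g_sub_mean:
  assumes s: "s \<in> D"
  shows "\<exists>r>0. \<forall>\<rho>\<in>{0<..<r}. \<forall>c A B.
    (\<forall>\<theta>. g (s + logdisc (\<rho> *\<^sub>R t) \<theta>) \<le> ereal (c + A * cos \<theta> + B * cos (2 * \<theta>))) \<longrightarrow> g s \<le> ereal c"
proof -
  define \<epsilon> where "\<epsilon> = Min (range (\<lambda>j. L - s $ j))"
  define N where "N = norm t + 1"
  have N: "N > 0" by (simp add: N_def add_nonneg_pos)
  have e0: "\<epsilon> > 0" using s by (simp add: \<epsilon>_def D_def)
  have e: "s $ j + \<epsilon> \<le> L" for j
  proof -
    have "\<epsilon> \<le> L - s $ j" unfolding \<epsilon>_def by (intro Min_le) auto
    then show ?thesis by simp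
  qed
  \<comment> \<open>The first bound keeps every coordinate away from 0 on the circle; the second
    keeps the closed disc in the polydisc, by 1 + x \<le> exp x.\<close>
  define r where "r = Min {1 / (2 * N), \<epsilon> / N}"
  have "r > 0" using e0 N by (simp add: r_def)
  moreover have "g s \<le> ereal c" if \<rho>: "\<rho> \<in> {0<..<r}"
    and le: "\<And>\<theta>. g (s + logdisc (\<rho> *\<^sub>R t) \<theta>) \<le> ereal (c + A * cos \<theta> + B * cos (2 * \<theta>))" for \<rho> c A B
  proof -
    define w :: "complex ^ 'n" where "w = (\<chi> j. of_real (exp (s $ j) * (\<rho> * t $ j)))"
    have "\<rho> < 1 / (2 * N)" "\<rho> < \<epsilon> / N" using \<rho> by (auto simp: r_def)
    then have \<rho>N: "\<rho> * N < 1 / 2" "\<rho> * N < \<epsilon>" using N by (simp_all add: field_simps)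
    have \<rho>t: "\<bar>\<rho> * t $ j\<bar> \<le> \<rho> * N" for j
      using \<rho> component_le_norm_cart[of t j] by (auto simp: abs_mult N_def intro!: mult_left_mono)
    have zw: "(expvec s + \<zeta> *s w) $ j = of_real (exp (s $ j)) * (1 + of_real (\<rho> * t $ j) * \<zeta>)" for \<zeta> j
      by (simp add: expvec_def w_def algebra_simps)
    have dom: "cmod ((expvec s + \<zeta> *s w) $ j) < exp L" if "cmod \<zeta> \<le> 1" for \<zeta> j
    proof -
      have "cmod ((expvec s + \<zeta> *s w) $ j) = exp (s $ j) * cmod (1 + of_real (\<rho> * t $ j) * \<zeta>)"
        unfolding zw by (simp add: norm_mult)
      also have "cmod (1 + of_real (\<rho> * t $ j) * \<zeta>) \<le> 1 + \<bar>\<rho> * t $ j\<bar> * cmod \<zeta>"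
        by (rule norm_triangle_le) (simp add: norm_mult abs_mult)
      also have "\<dots> \<le> 1 + \<rho> * N * 1"
        using \<rho>t[of j] that by (intro add_mono mult_mono) auto
      also have "\<dots> \<le> exp (\<rho> * N)" using exp_ge_add_one_self[of "\<rho> * N"] by simp
      also have "exp (s $ j) * exp (\<rho> * N) = exp (s $ j + \<rho> * N)" by (simp add: exp_add)
      also have "\<dots> < exp L" using e[of j] \<rho>N by simp
      finally show ?thesis by simp
    qed
    have eq: "u (expvec s + cis \<theta> *s w) = g (s + logdisc (\<rho> *\<^sub>R t) \<theta>)" for \<theta>
    proof -
      have nz: "1 + of_real (\<rho> * t $ j) * cis \<theta> \<noteq> 0" for j
      proof
        assume "1 + of_real (\<rho> * t $ j) * cis \<theta> = 0"
        then have "cmod (of_real (\<rho> * t $ j) * cis \<theta>) = cmod (- 1)" by (simp only: add_eq_0_iff)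
        then have "\<bar>\<rho> * t $ j\<bar> = 1" by (simp add: norm_mult abs_mult)
        with \<rho>t[of j] \<rho>N show False by simp
      qed
      have "u (expvec s + cis \<theta> *s w) = g (\<chi> j. ln (cmod ((expvec s + cis \<theta> *s w) $ j)))"
        using nz by (intro u_eq_g dom) (simp_all only: zw, auto)
      also have "(\<chi> j. ln (cmod ((expvec s + cis \<theta> *s w) $ j))) = s + logdisc (\<rho> *\<^sub>R t) \<theta>"
      proof (rule vec_eq_iff[THEN iffD2], rule allI)
        fix j
        have "cmod ((expvec s + cis \<theta> *s w) $ j) = exp (s $ j) * cmod (1 + of_real (\<rho> * t $ j) * cis \<theta>)"
          unfolding zw by (simp add: norm_mult)
        then show "(\<chi> j. ln (cmod ((expvec s + cis \<theta> *s w) $ j))) $ j = (s + logdisc (\<rho> *\<^sub>R t) \<theta>) $ j"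
          using nz[of j] by (simp add: ln_mult_pos logdisc_def)
      qed
      finally show ?thesis .
    qed
    have "u (expvec s) \<le> circle_mean u (expvec s) w"
      using psh polydisc dom unfolding psh_on_def by blast
    also have "\<dots> \<le> ereal c"
      by (rule circle_mean_le_trigonometric) (unfold eq, rule le)
    finally show ?thesis by (simp add: g_def)
  qed
  ultimately show ?thesis by blast
qed

lemma convex_g: "convex (epigraph_on D g)"
proof (rule convex_epigraph_on[OF open_D convex_D usc_g _ g_sub_mean])
  show "g s < \<infinity>" if "s \<in> D" for s using g_le[OF that] by (auto intro: le_less_trans)
qed

lemma g_convexD:
  assumes "s \<in> D" "s' \<in> D" "g s \<le> ereal c" "g s' \<le> ereal c'" "0 \<le> l" "l \<le> 1"
  shows "g ((1 - l) *\<^sub>R s + l *\<^sub>R s') \<le> ereal ((1 - l) * c + l * c')"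
proof -
  have "(1 - l) *\<^sub>R (s, c) + l *\<^sub>R (s', c') \<in> epigraph_on D g"
    using assms by (intro convexD[OF convex_g]) (auto simp: epigraph_on_def)
  then show ?thesis by (simp add: epigraph_on_def)
qed

text \<open>A convex function bounded above near \<open>-\<infinity>\<close> cannot decrease.\<close>

lemma g_mono:
  assumes "s' \<in> D" "\<And>j. s $ j \<le> s' $ j"
  shows "g s \<le> g s'"
proof (rule ereal_le_real)
  fix c assume c: "g s' \<le> ereal c"
  show "g s \<le> ereal c"
  proof (rule ereal_le_epsilon2)
    fix e :: real assume e: "e > 0"
    \<comment> \<open>The segment from s' to s is prolonged beyond s by r times its length, to p.
      Then s is a convex combination in which p has weight 1 / (1 + r), so the bound M at p costs at
      most e.\<close>
    define r where "r = \<bar>M - c\<bar> / e"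
    define l where "l = r / (1 + r)"
    define p where "p = s - r *\<^sub>R (s' - s)"
    have r: "r \<ge> 0" using e by (simp add: r_def)
    have l: "0 \<le> l" "l \<le> 1" "1 - l = 1 / (1 + r)" using r by (auto simp: l_def field_simps)
    have "p $ j \<le> s' $ j" for j
    proof -
      have "0 \<le> r * (s' $ j - s $ j)" using r assms(2)[of j] by simp
      then show ?thesis using assms(2)[of j] unfolding p_def by simp
    qed
    then have p: "p \<in> D" using assms(1) by (auto simp: D_def intro: le_less_trans)
    have "(1 - l) *\<^sub>R p + l *\<^sub>R s' = s"
    proof -
      have "(1 - l) *\<^sub>R p + l *\<^sub>R s' = (1 / (1 + r)) *\<^sub>R (p + r *\<^sub>R s')"
        unfolding l(3) by (simp add: l_def algebra_simps)
      also have "p + r *\<^sub>R s' = (1 + r) *\<^sub>R s" by (simp add: p_def algebra_simps)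
      finally show ?thesis using r by simp
    qed
    with g_convexD[OF p assms(1) g_le[OF p] c l(1,2)]
    have "g s \<le> ereal ((1 - l) * M + l * c)" by simp
    also have "(1 - l) * M + l * c = c + (1 - l) * (M - c)" by (simp add: algebra_simps)
    also have "(1 - l) * (M - c) \<le> e"
    proof -
      have "(1 - l) * (M - c) \<le> (1 / (1 + r)) * \<bar>M - c\<bar>" unfolding l(3) using r by (intro mult_left_mono) auto
      also have "\<bar>M - c\<bar> = r * e" using e by (simp add: r_def)
      also have "1 / (1 + r) * (r * e) \<le> e" using r e by (simp add: field_simps)
      finally show ?thesis .
    qed
    finally show "g s \<le> ereal c + ereal e" by simp
  qed
qed

text \<open>
  Points with vanishing coordinates have no logarithmic image; the mean over a circle in these
  coordinates has one.
\<close>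

lemma u_le_g:
  assumes "s \<in> D" "\<And>j. cmod (z $ j) \<le> exp (s $ j)"
  shows "u z \<le> g s"
proof (rule ereal_le_real)
  fix c assume c: "g s \<le> ereal c"
  \<comment> \<open>Only the vanishing coordinates are moved, and on the circle they have modulus
    exp (s_j). Hence all points of the circle have the same logarithmic image s', and a constant
    majorant suffices.\<close>
  define w :: "complex ^ 'n" where "w = (\<chi> j. if z $ j = 0 then of_real (exp (s $ j)) else 0)"
  define s' where "s' = (\<chi> j. if z $ j = 0 then s $ j else ln (cmod (z $ j)))"
  have sL: "exp (s $ j) < exp L" for j using assms(1) by (simp add: D_def)
  have le: "cmod ((z + \<zeta> *s w) $ j) \<le> exp (s $ j)" if "cmod \<zeta> \<le> 1" for \<zeta> j
    using assms(2)[of j] that by (simp add: w_def norm_mult mult_left_le_one_le)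
  have dom: "cmod ((z + \<zeta> *s w) $ j) < exp L" if "cmod \<zeta> \<le> 1" for \<zeta> j
    using le[OF that, of j] sL[of j] by linarith
  have "u (z + cis \<theta> *s w) \<le> ereal c" for \<theta>
  proof -
    have "u (z + cis \<theta> *s w) = g (\<chi> j. ln (cmod ((z + cis \<theta> *s w) $ j)))"
      by (intro u_eq_g dom) (auto simp: w_def)
    also have "(\<chi> j. ln (cmod ((z + cis \<theta> *s w) $ j))) = s'"
      by (auto simp: vec_eq_iff s'_def w_def norm_mult)
    also have "g s' \<le> g s"
    proof (rule g_mono[OF assms(1)])
      show "s' $ j \<le> s $ j" for j
      proof (cases "z $ j = 0")
        case False
        with assms(2)[of j] have "ln (cmod (z $ j)) \<le> ln (exp (s $ j))"
          by (subst ln_le_cancel_iff) auto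
        with False show ?thesis by (simp add: s'_def)
      qed (simp add: s'_def)
    qed
    finally show ?thesis using c by (rule order_trans)
  qed
  then have "circle_mean u z w \<le> ereal c"
    by (intro circle_mean_le_trigonometric[of u z w c 0 0]) simp
  moreover have "u z \<le> circle_mean u z w"
    using psh polydisc dom unfolding psh_on_def by blast
  ultimately show "u z \<le> ereal c" by simp
qed

end

subsection \<open>The indicator diagram and linear growth\<close>

text \<open>Sublevel sets of \<open>phi a\<close> are closed polydiscs with radii exp (-r a_k). This
  links the quotient in \<open>nu\<close> with the values of g on the ray spanned by -a.\<close>

lemma phi_le_iff:
  assumes a: "\<And>k. 0 < a $ k"
  shows "phi a x \<le> ereal (- r) \<longleftrightarrow> (\<forall>k. cmod (x $ k) \<le> exp (- (r * a $ k)))"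
proof -
  have "ereal (inverse (a $ k)) * elog (cmod (x $ k)) \<le> ereal (- r) \<longleftrightarrow> cmod (x $ k) \<le> exp (- (r * a $ k))" for k
  proof (cases "x $ k = 0")
    case True
    then show ?thesis using a[of k] by (simp add: elog_def)
  next
    case False
    have "inverse (a $ k) * ln (cmod (x $ k)) \<le> - r \<longleftrightarrow> ln (cmod (x $ k)) \<le> - (r * a $ k)"
      using a[of k] by (simp add: field_simps)
    also have "\<dots> \<longleftrightarrow> cmod (x $ k) \<le> exp (- (r * a $ k))"
      using False by (metis exp_le_cancel_iff exp_ln norm_eq_zero zero_less_norm_iff)
    finally show ?thesis using False by (simp add: elog_def)
  qed
  then show ?thesis by (simp add: phi_def)
qed

lemma phi_finite:
  assumes "\<And>k. 0 < a $ k" "x \<noteq> 0"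
  shows "phi a x \<noteq> \<infinity>" "phi a x \<noteq> -\<infinity>"
proof -
  obtain k where k: "x $ k \<noteq> 0" using assms(2) by (auto simp: vec_eq_iff)
  have "-\<infinity> < ereal (inverse (a $ k)) * elog (cmod (x $ k))" using k by (simp add: elog_def)
  also have "\<dots> \<le> phi a x" unfolding phi_def by (intro Max_ge) auto
  finally show "phi a x \<noteq> -\<infinity>" by simp
  have "ereal (inverse (a $ k)) * elog (cmod (x $ k)) < \<infinity>" for k
    using assms(1)[of k] by (simp add: elog_def)
  then have "phi a x < \<infinity>" unfolding phi_def by (subst Max_less_iff) auto
  then show "phi a x \<noteq> \<infinity>" by simp
qed

lemma eventually_cmod_le_exp:
  fixes \<tau> :: "real ^ 'n"
  shows "\<forall>\<^sub>F x in at (0 :: complex ^ 'n). \<forall>k. cmod (x $ k) \<le> exp (\<tau> $ k)"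
proof -
  have "\<forall>\<^sub>F x in at (0 :: complex ^ 'n). cmod (x $ k) < exp (\<tau> $ k)" for k
  proof (rule order_tendstoD(2))
    show "((\<lambda>x::complex ^ 'n. cmod (x $ k)) \<longlongrightarrow> cmod ((0::complex ^ 'n) $ k)) (at 0)"
      by (intro tendsto_intros)
  qed simp
  then have "\<forall>\<^sub>F x in at (0 :: complex ^ 'n). \<forall>k\<in>UNIV. cmod (x $ k) < exp (\<tau> $ k)"
    by (intro eventually_ball_finite) auto
  then show ?thesis by eventually_elim (auto intro: less_imp_le)
qed

context multicircled_psh
begin

text \<open>Otherwise g is at most a r on the whole ray beyond R. A point x near 0 with
  \<open>phi\<close> equal to -r then has u x \<le> a r, and division by -r gives a quotient of at
  least -a; so \<open>nu\<close> is at least -a, against the assumption.\<close>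

lemma frequently_g_ray:
  assumes \<tau>: "\<tau> \<in> neg_orthant" and a: "ereal a < Psi_hat u \<tau>" and R: "R > 0" "R *\<^sub>R \<tau> \<in> D"
  shows "\<exists>r\<ge>R. ereal (a * r) < g (r *\<^sub>R \<tau>)"
proof (rule ccontr)
  assume "\<not> ?thesis"
  then have le: "g (r *\<^sub>R \<tau>) \<le> ereal (a * r)" if "r \<ge> R" for r using that by (auto simp: not_less)
  have neg: "0 < (- \<tau>) $ k" for k using \<tau> by (simp add: neg_orthant_def)
  have "\<forall>\<^sub>F x in at 0. ereal (- a) \<le> u x / phi (- \<tau>) x"
    using eventually_cmod_le_exp[of "R *\<^sub>R \<tau>"] eventually_neq_at_within[of 0 0 UNIV]
  proof eventually_elim
    case (elim x)
    obtain r where r: "phi (- \<tau>) x = ereal (- r)"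
      using phi_finite[OF neg elim(2)] by (cases "phi (- \<tau>) x") (auto intro: that[of "- real_of_ereal (phi (- \<tau>) x)"])
    have "phi (- \<tau>) x \<le> ereal (- R)" using elim(1) unfolding phi_le_iff[OF neg] by simp
    then have rR: "R \<le> r" using r by simp
    have "(r - R) * \<tau> $ j \<le> 0" for j using rR \<tau> by (intro mult_nonneg_nonpos) (auto simp: neg_orthant_def less_imp_le)
    then have "(r *\<^sub>R \<tau>) $ j \<le> (R *\<^sub>R \<tau>) $ j" for j by (simp add: algebra_simps)
    then have rD: "r *\<^sub>R \<tau> \<in> D" using R(2) unfolding D_def by (auto intro: le_less_trans)
    have "phi (- \<tau>) x \<le> ereal (- r)" using r by simp
    then have "u x \<le> g (r *\<^sub>R \<tau>)" unfolding phi_le_iff[OF neg] by (intro u_le_g[OF rD]) simp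
    also have "\<dots> \<le> ereal (a * r)" by (rule le[OF rR])
    finally have "u x \<le> ereal (a * r)" .
    moreover have "r > 0" using rR R by simp
    ultimately show ?case unfolding r by (cases "u x") (auto simp: field_simps)
  qed
  then have "ereal (- a) \<le> nu u (- \<tau>)" unfolding nu_def by (rule Liminf_bounded)
  with a show False unfolding Psi_hat_def by (metis ereal_uminus_le_reorder not_le uminus_ereal.simps(1))
qed

text \<open>Chord slopes of a convex function increase: one far point above the line of slope a
  forces slope at least b from there on. This upgrades "for some large r" to "for all large
  r".\<close>

lemma g_ray_lower_bound:
  assumes \<tau>: "\<tau> \<in> neg_orthant" and a: "ereal a < Psi_hat u \<tau>" and "b < a"
  shows "\<exists>r0 C. \<forall>r\<ge>r0. r *\<^sub>R \<tau> \<in> D \<and> ereal (b * r - C) \<le> g (r *\<^sub>R \<tau>)"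
proof -
  define m where "m = Min (range (\<lambda>j. - \<tau> $ j))"
  have m0: "m > 0" using \<tau> by (simp add: m_def neg_orthant_def)
  have m: "\<tau> $ j \<le> - m" for j
  proof -
    have "m \<le> - \<tau> $ j" unfolding m_def by (intro Min_le) auto
    then show ?thesis by simp
  qed
  define r1 where "r1 = (\<bar>L\<bar> + 1) / m"
  have r1: "r1 > 0" "r1 * m = \<bar>L\<bar> + 1" using m0 by (auto simp: r1_def)
  have inD: "r *\<^sub>R \<tau> \<in> D" if "r \<ge> r1" for r
  proof -
    have "r * \<tau> $ j < L" for j
    proof -
      have "r * \<tau> $ j \<le> r * (- m)" using that r1 m by (intro mult_left_mono) auto
      also have "\<dots> \<le> r1 * (- m)" using that m0 by simp
      also have "\<dots> < L" using r1 by simp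
      finally show ?thesis .
    qed
    then show ?thesis by (simp add: D_def)
  qed
  \<comment> \<open>Beyond the second bound, the chord from height M at r1 to height a r at r has
    slope at least b.\<close>
  define R where "R = max (r1 + 1) ((M - b * r1) / (a - b))"
  have R: "R > r1" "R > 0" using r1 by (auto simp: R_def)
  obtain r2 where r2: "r2 \<ge> R" "ereal (a * r2) < g (r2 *\<^sub>R \<tau>)"
    using frequently_g_ray[OF \<tau> a R(2) inD] R by auto
  have "(M - b * r1) / (a - b) \<le> r2" using r2(1) by (simp add: R_def)
  then have slope: "b * (r2 - r1) \<le> a * r2 - M" using assms(3) by (simp add: field_simps)
  have "ereal (b * r - (b * r1 - M)) \<le> g (r *\<^sub>R \<tau>)" if r: "r \<ge> r2" for r
  proof (rule ereal_le_real)
    fix c assume c: "g (r *\<^sub>R \<tau>) \<le> ereal c"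
    define l where "l = (r2 - r1) / (r - r1)"
    have rr: "r1 < r2" "r1 < r" using r r2(1) R by auto
    then have l: "0 < l" "l \<le> 1" "l * (r - r1) = r2 - r1" using r by (auto simp: l_def)
    have D1: "r1 *\<^sub>R \<tau> \<in> D" and D2: "r *\<^sub>R \<tau> \<in> D" using rr by (auto intro: inD)
    have "(1 - l) * r1 + l * r = r2" using l(3) by (simp add: algebra_simps)
    then have "(1 - l) *\<^sub>R (r1 *\<^sub>R \<tau>) + l *\<^sub>R (r *\<^sub>R \<tau>) = r2 *\<^sub>R \<tau>"
      by (simp flip: scaleR_add_left)
    with g_convexD[OF D1 D2 g_le[OF D1] c, of l] l
    have "g (r2 *\<^sub>R \<tau>) \<le> ereal ((1 - l) * M + l * c)" by simp
    with r2(2) have "ereal (a * r2) < ereal ((1 - l) * M + l * c)" by (rule less_le_trans)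
    then have "a * r2 < (1 - l) * M + l * c" by simp
    with slope have "b * (l * (r - r1)) < l * (c - M)" unfolding l(3) by (simp add: algebra_simps)
    then have "l * (b * (r - r1)) < l * (c - M)" by (simp add: mult_ac)
    then have "b * (r - r1) < c - M" using l(1) by simp
    then show "ereal (b * r - (b * r1 - M)) \<le> ereal c" by (simp add: algebra_simps)
  qed
  moreover have "r *\<^sub>R \<tau> \<in> D" if "r \<ge> r2" for r using that r2(1) R(1) by (intro inD) simp
  ultimately show ?thesis by blast
qed

text \<open>For s with negative entries,
  \<open>(\<beta> - \<epsilon> *\<^sub>R 1) \<bullet> s\<close> equals \<beta> . s plus \<epsilon>
  times the sum of the |s_j|; linear growth is thus the case of a vector \<gamma> lowered along the
  diagonal.\<close>

definition growth :: "real ^ 'n \<Rightarrow> bool" where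
  "growth \<gamma> \<longleftrightarrow> (\<exists>R C. \<forall>s. (\<forall>j. s $ j \<le> - R) \<longrightarrow> s \<in> D \<and> ereal (\<gamma> \<bullet> s - C) \<le> g s)"

text \<open>
  By monotonicity the lower bounds along the finitely many rays spanned by a grid of directions
  suffice, so that no uniformity in the direction is needed.
\<close>

lemma growth_of_Psi_hat:
  assumes \<gamma>: "\<And>t. t \<in> neg_orthant \<Longrightarrow> ereal (\<gamma> \<bullet> t) \<le> Psi_hat u t" and \<eta>: "\<eta> > 0"
  shows "growth (\<gamma> + \<eta> *\<^sub>R 1)"
proof -
  define G where "G = (\<Sum>j\<in>UNIV. \<bar>\<gamma> $ j\<bar>)"
  \<comment> \<open>The mesh 1 / N is so fine that rounding a point to the grid changes \<gamma> . s
    by at most \<eta> r / 2.\<close>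
  obtain N :: nat where N: "2 * G / \<eta> + 1 \<le> real N" using real_arch_simple by blast
  have G0: "G \<ge> 0" by (auto simp: G_def intro: sum_nonneg)
  have N1: "N \<ge> 1" using N G0 \<eta> by (smt (verit) divide_nonneg_pos of_nat_less_1_iff not_le of_nat_1)
  have GN: "G / N \<le> \<eta> / 2" using N N1 \<eta> by (simp add: field_simps)
  define \<tau> :: "('n \<Rightarrow> nat) \<Rightarrow> real ^ 'n" where "\<tau> = (\<lambda>f. \<chi> j. - (real (f j) / N))"
  define F where "F = (UNIV :: 'n set) \<rightarrow>\<^sub>E {1..N + 1}"
  have finF: "finite F" unfolding F_def by (intro finite_PiE) auto
  have \<tau>neg: "\<tau> f \<in> neg_orthant" if "f \<in> F" for f
  proof -
    have "f j \<in> {1..N + 1}" for j using that unfolding F_def by (rule PiE_mem) simp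
    then have "0 < real (f j) / real N" for j using N1 by (simp add: Suc_le_eq)
    then show ?thesis by (simp add: neg_orthant_def \<tau>_def)
  qed
  have "\<forall>f\<in>F. \<exists>p. \<forall>r\<ge>fst p. r *\<^sub>R \<tau> f \<in> D \<and> ereal ((\<gamma> \<bullet> \<tau> f - \<eta> / 2) * r - snd p) \<le> g (r *\<^sub>R \<tau> f)"
  proof
    fix f assume f: "f \<in> F"
    have "ereal (\<gamma> \<bullet> \<tau> f - \<eta> / 4) < ereal (\<gamma> \<bullet> \<tau> f)" using \<eta> by simp
    also have "\<dots> \<le> Psi_hat u (\<tau> f)" by (intro \<gamma> \<tau>neg f)
    finally have "ereal (\<gamma> \<bullet> \<tau> f - \<eta> / 4) < Psi_hat u (\<tau> f)" .
    from g_ray_lower_bound[OF \<tau>neg[OF f] this, of "\<gamma> \<bullet> \<tau> f - \<eta> / 2"] \<eta>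
    obtain r0 C where "\<forall>r\<ge>r0. r *\<^sub>R \<tau> f \<in> D \<and> ereal ((\<gamma> \<bullet> \<tau> f - \<eta> / 2) * r - C) \<le> g (r *\<^sub>R \<tau> f)"
      by auto
    then show "\<exists>p. \<forall>r\<ge>fst p. r *\<^sub>R \<tau> f \<in> D \<and> ereal ((\<gamma> \<bullet> \<tau> f - \<eta> / 2) * r - snd p) \<le> g (r *\<^sub>R \<tau> f)"
      by (intro exI[of _ "(r0, C)"]) simp
  qed
  from bchoice[OF this] obtain p where
    p: "\<forall>f\<in>F. \<forall>r\<ge>fst (p f). r *\<^sub>R \<tau> f \<in> D \<and> ereal ((\<gamma> \<bullet> \<tau> f - \<eta> / 2) * r - snd (p f)) \<le> g (r *\<^sub>R \<tau> f)"
    by (rule exE)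
  define R where "R = Max (insert 1 (insert (1 - L) ((fst \<circ> p) ` F)))"
  define C where "C = Max (insert 0 ((snd \<circ> p) ` F))"
  have R: "R \<ge> 1" "R \<ge> 1 - L" unfolding R_def by (intro Max_ge; use finF in simp)+
  have RF: "fst (p f) \<le> R" if "f \<in> F" for f unfolding R_def using finF that by (intro Max_ge) auto
  have CF: "snd (p f) \<le> C" if "f \<in> F" for f unfolding C_def using finF that by (intro Max_ge) auto
  have "s \<in> D \<and> ereal ((\<gamma> + \<eta> *\<^sub>R 1) \<bullet> s - C) \<le> g s" if s: "\<And>j. s $ j \<le> - R" for s
  proof
    show sD: "s \<in> D" using s R by (auto simp: D_def intro!: le_less_trans[OF s])
    \<comment> \<open>With this scale the entries of s / r lie in [-1, 0], and the added \<eta> on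
      the diagonal contributes exactly -\<eta> r. One half of it pays for the rounding, the other
      for the loss of slope on the rays.\<close>
    define r where "r = - (\<Sum>j\<in>UNIV. s $ j)"
    have s0: "s $ j \<le> 0" for j using s[of j] R by simp
    have sr: "- s $ j \<le> r" for j
      unfolding r_def sum_negf[symmetric] using s0 by (intro member_le_sum) auto
    have rR: "R \<le> r" using sr[of undefined] s[of undefined] by simp
    with R have r0: "r > 0" by simp
    \<comment> \<open>Floor plus one gives indices from 1 to N + 1, so the direction is strictly
      negative. It also puts \<open>r *\<^sub>R \<tau> f\<close> below s, the side on which
      monotonicity yields a lower bound for g s.\<close>
    define f where "f = (\<lambda>j. nat \<lfloor>N * (- s $ j) / r\<rfloor> + 1)"
    have q: "0 \<le> N * (- s $ j) / r" "N * (- s $ j) / r \<le> N" for j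
    proof -
      show "0 \<le> N * (- s $ j) / r"
        using s0[of j] r0 by (intro divide_nonneg_nonneg mult_nonneg_nonneg) auto
      have "N * (- s $ j) \<le> N * r" using sr[of j] by (intro mult_left_mono) auto
      then show "N * (- s $ j) / r \<le> N" using r0 by (simp only: pos_divide_le_eq)
    qed
    have f1: "N * (- s $ j) / r \<le> f j" "f j \<le> N * (- s $ j) / r + 1" for j
      using q(1)[of j] unfolding f_def by linarith+
    have "f \<in> F"
    proof -
      have "f j \<le> N + 1" for j
        using f1(2)[of j] q(2)[of j] by linarith
      then show ?thesis by (auto simp: F_def f_def)
    qed
    have ge: "(r *\<^sub>R \<tau> f) $ j \<le> s $ j" "s $ j - r / N \<le> (r *\<^sub>R \<tau> f) $ j" for j
    proof -
      have N0: "0 < real N" using N1 by simp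
      have AB: "N * (- s $ j) \<le> r * f j" "r * f j \<le> N * (- s $ j) + r"
        using f1[of j] r0 by (simp_all add: field_simps)
      have e: "(r *\<^sub>R \<tau> f) $ j = - (r * f j / N)" by (simp add: \<tau>_def)
      have "- s $ j \<le> r * f j / N" using AB(1) N0 by (simp add: pos_le_divide_eq mult.commute)
      then show "(r *\<^sub>R \<tau> f) $ j \<le> s $ j" unfolding e by simp
      have "r * f j / N \<le> (N * (- s $ j) + r) / N" using AB(2) N0 by (intro divide_right_mono) auto
      also have "\<dots> = - s $ j + r / N" using N0 by (simp add: add_divide_distrib diff_divide_distrib)
      finally show "s $ j - r / N \<le> (r *\<^sub>R \<tau> f) $ j" unfolding e by simp
    qed
    have "\<gamma> \<bullet> s - \<gamma> \<bullet> (r *\<^sub>R \<tau> f) = (\<Sum>j\<in>UNIV. \<gamma> $ j * (s $ j - (r *\<^sub>R \<tau> f) $ j))"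
      by (simp add: inner_vec_def sum_subtractf right_diff_distrib)
    also have "\<dots> \<le> (\<Sum>j\<in>UNIV. \<bar>\<gamma> $ j\<bar> * (r / N))"
    proof (rule sum_mono)
      fix j
      have "\<gamma> $ j * (s $ j - (r *\<^sub>R \<tau> f) $ j) \<le> \<bar>\<gamma> $ j\<bar> * (s $ j - (r *\<^sub>R \<tau> f) $ j)"
        using ge(1)[of j] by (intro mult_right_mono) auto
      also have "\<dots> \<le> \<bar>\<gamma> $ j\<bar> * (r / N)" using ge(2)[of j] by (intro mult_left_mono) auto
      finally show "\<gamma> $ j * (s $ j - (r *\<^sub>R \<tau> f) $ j) \<le> \<bar>\<gamma> $ j\<bar> * (r / N)" .
    qed
    also have "\<dots> = G / N * r" by (simp add: G_def sum_divide_distrib sum_distrib_right)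
    also have "\<dots> \<le> \<eta> / 2 * r" using GN r0 by (intro mult_right_mono) auto
    finally have 1: "\<gamma> \<bullet> s - \<eta> / 2 * r \<le> (\<gamma> \<bullet> \<tau> f) * r" by (simp add: mult.commute)
    have "(\<gamma> + \<eta> *\<^sub>R 1) \<bullet> s = \<gamma> \<bullet> s - \<eta> * r"
      unfolding inner_add_left by (simp add: r_def inner_vec_def sum_distrib_left)
    then have "(\<gamma> + \<eta> *\<^sub>R 1) \<bullet> s - C \<le> (\<gamma> \<bullet> \<tau> f - \<eta> / 2) * r - snd (p f)"
      using 1 CF[OF \<open>f \<in> F\<close>] by (simp add: algebra_simps)
    then have "ereal ((\<gamma> + \<eta> *\<^sub>R 1) \<bullet> s - C) \<le> ereal ((\<gamma> \<bullet> \<tau> f - \<eta> / 2) * r - snd (p f))" by simp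
    also have "\<dots> \<le> g (r *\<^sub>R \<tau> f)" using p \<open>f \<in> F\<close> RF[OF \<open>f \<in> F\<close>] rR by auto
    also have "\<dots> \<le> g s" by (rule g_mono[OF sD ge(1)])
    finally show "ereal ((\<gamma> + \<eta> *\<^sub>R 1) \<bullet> s - C) \<le> g s" .
  qed
  then show ?thesis unfolding growth_def by blast
qed

text \<open>The liminf is tested at the points \<open>expvec (r *\<^sub>R t)\<close>, where
  \<open>phi (- t)\<close> is exactly -r; the quotient there is at most -(\<gamma> . t) + C /
  r.\<close>

lemma Psi_hat_of_growth:
  assumes "growth \<gamma>" and t: "t \<in> neg_orthant"
  shows "ereal (\<gamma> \<bullet> t) \<le> Psi_hat u t"
proof -
  obtain R C where RC: "\<And>s. (\<And>j. s $ j \<le> - R) \<Longrightarrow> s \<in> D \<and> ereal (\<gamma> \<bullet> s - C) \<le> g s"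
    using assms(1) unfolding growth_def by blast
  have t0: "t $ j < 0" for j using t by (simp add: neg_orthant_def)
  have neg: "0 < (- t) $ k" for k using t by (simp add: neg_orthant_def)
  have tend: "filterlim (\<lambda>r. r * t $ j) at_bot at_top" for j
    using filterlim_tendsto_neg_mult_at_bot[OF tendsto_const t0 filterlim_ident, of j]
    by (simp add: mult.commute)
  have "((\<lambda>r. expvec (r *\<^sub>R t)) \<longlongrightarrow> 0) at_top"
  proof (rule vec_tendstoI)
    fix j
    have "((\<lambda>r. exp (r * t $ j)) \<longlongrightarrow> 0) at_top"
      by (rule filterlim_compose[OF exp_at_bot tend])
    from tendsto_of_real[OF this] show "((\<lambda>r. expvec (r *\<^sub>R t) $ j) \<longlongrightarrow> 0 $ j) at_top"
      by (simp add: expvec_def)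
  qed
  moreover have "expvec (r *\<^sub>R t) \<noteq> 0" for r by (auto simp: expvec_def vec_eq_iff)
  ultimately have lim: "filterlim (\<lambda>r. expvec (r *\<^sub>R t)) (at 0) at_top"
    by (auto simp: filterlim_at)
  have "nu u (- t) \<le> ereal (- (\<gamma> \<bullet> t))"
  proof (rule ccontr)
    assume "\<not> ?thesis"
    then have "ereal (- (\<gamma> \<bullet> t)) < nu u (- t)" by simp
    from ereal_dense2[OF this] obtain b where b: "- (\<gamma> \<bullet> t) < b" "ereal b < nu u (- t)" by auto
    have "\<forall>\<^sub>F x in at 0. ereal b < u x / phi (- t) x"
      using b(2) unfolding nu_def by (rule less_LiminfD)
    then have ev1: "\<forall>\<^sub>F r in at_top. ereal b < u (expvec (r *\<^sub>R t)) / phi (- t) (expvec (r *\<^sub>R t))"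
      using lim by (rule eventually_compose_filterlim)
    have ev2: "\<forall>\<^sub>F r in at_top. \<forall>j\<in>UNIV. r * t $ j \<le> - R"
      using tend by (intro eventually_ball_finite) (auto simp: filterlim_at_bot)
    have ev3: "\<forall>\<^sub>F r in at_top. r > max 0 (C / (b + \<gamma> \<bullet> t))" by (rule eventually_gt_at_top)
    from eventually_happens'[OF trivial_limit_at_top_linorder eventually_conj[OF ev1 eventually_conj[OF ev2 ev3]]]
    obtain r where r: "ereal b < u (expvec (r *\<^sub>R t)) / phi (- t) (expvec (r *\<^sub>R t))"
      "\<And>j. r * t $ j \<le> - R" "r > 0" "r > C / (b + \<gamma> \<bullet> t)" by auto
    have eq: "(\<lambda>k. ereal (inverse ((- t) $ k)) * elog (cmod (expvec (r *\<^sub>R t) $ k))) = (\<lambda>k. ereal (- r))"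
    proof
      fix k
      have "inverse (t $ k) * (r * t $ k) = r" using t0[of k] by simp
      then show "ereal (inverse ((- t) $ k)) * elog (cmod (expvec (r *\<^sub>R t) $ k)) = ereal (- r)"
        by (simp add: expvec_def elog_def del: mult_eq_0_iff)
    qed
    have phi: "phi (- t) (expvec (r *\<^sub>R t)) = ereal (- r)"
      unfolding phi_def eq by simp
    have "ereal (\<gamma> \<bullet> (r *\<^sub>R t) - C) \<le> u (expvec (r *\<^sub>R t))"
      using RC[of "r *\<^sub>R t"] r(2) by (simp add: g_def)
    moreover have "C < r * (b + \<gamma> \<bullet> t)" using r(4) b(1) by (simp add: field_simps)
    ultimately have "u (expvec (r *\<^sub>R t)) / ereal (- r) \<le> ereal b"
      using r(3) by (cases "u (expvec (r *\<^sub>R t))") (auto simp: field_simps)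
    with r(1) show False unfolding phi by simp
  qed
  then show ?thesis unfolding Psi_hat_def
    by (metis ereal_uminus_le_reorder uminus_ereal.simps(1) ereal_minus_le_minus)
qed

text \<open>Raising the entries of a vector lowers its product with a negative t, so the diagram is
  closed upwards and a neighbourhood of \<beta> is controlled by the single point \<beta> -
  \<epsilon> 1. One direction spends half of \<epsilon> on the loss in
  \<open>growth_of_Psi_hat\<close>; in the other, positivity of \<beta> keeps a small ball in the
  orthant.\<close>

lemma interior_indicator_diagram_iff_growth:
  assumes \<beta>: "\<And>j. 0 < \<beta> $ j"
  shows "\<beta> \<in> interior (indicator_diagram u) \<longleftrightarrow> (\<exists>\<epsilon>>0. growth (\<beta> - \<epsilon> *\<^sub>R 1))"
proof
  assume "\<beta> \<in> interior (indicator_diagram u)"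
  then obtain e where e: "e > 0" "cball \<beta> e \<subseteq> indicator_diagram u" by (auto simp: mem_interior_cball)
  have n0: "norm (1 :: real ^ 'n) > 0" by simp
  define \<epsilon> where "\<epsilon> = e / norm (1 :: real ^ 'n)"
  have \<epsilon>: "\<epsilon> > 0" using e n0 by (simp add: \<epsilon>_def)
  have "\<beta> - \<epsilon> *\<^sub>R 1 \<in> cball \<beta> e" using e n0 by (simp add: dist_norm \<epsilon>_def)
  with e(2) have "\<beta> - \<epsilon> *\<^sub>R 1 \<in> indicator_diagram u" by blast
  then have "growth (\<beta> - \<epsilon> *\<^sub>R 1 + (\<epsilon> / 2) *\<^sub>R 1)"
    using \<epsilon> by (intro growth_of_Psi_hat) (auto simp: indicator_diagram_def)
  also have "\<beta> - \<epsilon> *\<^sub>R 1 + (\<epsilon> / 2) *\<^sub>R 1 = \<beta> - (\<epsilon> / 2) *\<^sub>R 1"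
    by (simp add: vec_eq_iff)
  finally show "\<exists>\<epsilon>>0. growth (\<beta> - \<epsilon> *\<^sub>R 1)" using \<epsilon> by (intro exI[of _ "\<epsilon> / 2"]) simp
next
  assume "\<exists>\<epsilon>>0. growth (\<beta> - \<epsilon> *\<^sub>R 1)"
  then obtain \<epsilon> where \<epsilon>: "\<epsilon> > 0" "growth (\<beta> - \<epsilon> *\<^sub>R 1)" by blast
  define e where "e = min \<epsilon> (Min (range (\<lambda>j. \<beta> $ j)))"
  have e0: "e > 0" using \<epsilon> \<beta> by (simp add: e_def)
  have "ball \<beta> e \<subseteq> indicator_diagram u"
  proof
    fix \<beta>' assume "\<beta>' \<in> ball \<beta> e"
    then have d: "\<bar>\<beta> $ j - \<beta>' $ j\<bar> < e" for j
      using component_le_norm_cart[of "\<beta> - \<beta>'" j] by (simp add: dist_norm)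
    have e: "e \<le> \<epsilon>" "e \<le> \<beta> $ j" for j by (auto simp: e_def intro!: min.coboundedI2 Min_le)
    have "0 < \<beta>' $ j" for j using d[of j] e(2)[of j] by linarith
    then have "\<beta>' \<in> closure pos_orthant" by (intro closure_subset[THEN subsetD]) (simp add: pos_orthant_def)
    moreover have "ereal (\<beta>' \<bullet> t) \<le> Psi_hat u t" if t: "t \<in> neg_orthant" for t
    proof -
      have "\<beta>' \<bullet> t \<le> (\<beta> - \<epsilon> *\<^sub>R 1) \<bullet> t"
        unfolding inner_vec_def
      proof (rule sum_mono)
        fix j
        have "(\<beta> - \<epsilon> *\<^sub>R 1) $ j \<le> \<beta>' $ j" using d[of j] e(1) by simp
        then show "\<beta>' $ j \<bullet> t $ j \<le> (\<beta> - \<epsilon> *\<^sub>R 1) $ j \<bullet> t $ j"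
          using t by (auto simp: neg_orthant_def intro!: mult_right_mono_neg less_imp_le)
      qed
      then have "ereal (\<beta>' \<bullet> t) \<le> ereal ((\<beta> - \<epsilon> *\<^sub>R 1) \<bullet> t)" by simp
      also have "\<dots> \<le> Psi_hat u t" by (rule Psi_hat_of_growth[OF \<epsilon>(2) t])
      finally show ?thesis .
    qed
    ultimately show "\<beta>' \<in> indicator_diagram u" by (simp add: indicator_diagram_def)
  qed
  with e0 show "\<beta> \<in> interior (indicator_diagram u)" by (auto simp: mem_interior)
qed

end

subsection \<open>Integrability and linear growth\<close>

text \<open>Translates between the complex coordinates and the real ones, with respect to which
  Lebesgue measure is a product.\<close>

lemma prod_Basis_complex_vec:
  fixes h :: "real \<Rightarrow> 'a::comm_monoid_mult" and z :: "complex ^ 'n"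
  shows "(\<Prod>b\<in>Basis. h (z \<bullet> b)) = (\<Prod>j\<in>UNIV. h (Re (z $ j)) * h (Im (z $ j)))"
proof -
  have "bij_betw (\<lambda>(j, v). axis j v) (UNIV \<times> (Basis :: complex set)) (Basis :: (complex ^ 'n) set)"
    unfolding bij_betw_def
  proof
    show "inj_on (\<lambda>(j, v). axis j v) (UNIV \<times> (Basis :: complex set))"
      by (auto simp: inj_on_def axis_eq_axis dest: nonzero_Basis)
    show "(\<lambda>(j, v). axis j v) ` (UNIV \<times> (Basis :: complex set)) = (Basis :: (complex ^ 'n) set)"
      by (auto simp: Basis_vec_def)
  qed
  from prod.reindex_bij_betw[OF this, of "\<lambda>b. h (z \<bullet> b)"]
  have "(\<Prod>b\<in>Basis. h (z \<bullet> b)) = (\<Prod>(j, v)\<in>UNIV \<times> Basis. h (z $ j \<bullet> v))"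
    by (simp add: inner_axis split_beta)
  also have "\<dots> = (\<Prod>j\<in>UNIV. \<Prod>v\<in>Basis. h (z $ j \<bullet> v))"
    by (simp add: prod.cartesian_product)
  finally show ?thesis by (simp add: Basis_complex_def)
qed

lemma nn_integral_abs_powr_finite:
  assumes "-1 < (a::real)"
  shows "(\<integral>\<^sup>+x. ennreal (\<bar>x\<bar> powr a) * indicator {-1..1} x \<partial>lborel) < \<infinity>"
proof -
  let ?f = "\<lambda>x. ennreal (x powr a) * indicator {0..1} x"
  have f: "(\<integral>\<^sup>+x. ?f x \<partial>lborel) < \<infinity>"
    using nn_integral_has_integral_lebesgue'[OF _ has_integral_powr_from_0[OF assms, of 1]] by simp
  have m: "?f \<in> borel_measurable borel" by measurable
  have "(\<integral>\<^sup>+x. ennreal (\<bar>x\<bar> powr a) * indicator {-1..1} x \<partial>lborel) \<le> (\<integral>\<^sup>+x. ?f x + ?f (- x) \<partial>lborel)"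
    by (intro nn_integral_mono) (auto simp: indicator_def abs_if)
  also have "\<dots> = (\<integral>\<^sup>+x. ?f x \<partial>lborel) + (\<integral>\<^sup>+x. ?f (- x) \<partial>lborel)"
    by (rule nn_integral_add) (use m in measurable)
  also have "(\<integral>\<^sup>+x. ?f (- x) \<partial>lborel) = (\<integral>\<^sup>+x. ?f x \<partial>lborel)"
    using nn_integral_real_affine[OF m, of "-1" 0] by simp
  also have "(\<integral>\<^sup>+x. ?f x \<partial>lborel) + (\<integral>\<^sup>+x. ?f x \<partial>lborel) < \<infinity>" using f by simp
  finally show ?thesis .
qed

lemma eexp_mono: "x \<le> y \<Longrightarrow> eexp x \<le> eexp y"
  by (cases x; cases y) (auto simp: eexp_def)

lemma eexp_ereal [simp]: "eexp (ereal r) = ennreal (exp r)"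
  by (simp add: eexp_def)

lemma measurable_eexp [measurable]: "eexp \<in> borel_measurable borel"
proof -
  have "eexp = (\<lambda>x. if x = \<infinity> then \<infinity> else if x = -\<infinity> then 0 else ennreal (exp (real_of_ereal x)))"
    by (auto simp: eexp_def fun_eq_iff split: ereal.splits)
  also have "\<dots> \<in> borel_measurable borel" by measurable
  finally show ?thesis .
qed

lemma usc_on_measurable_lebesgue:
  fixes u :: "'a::euclidean_space \<Rightarrow> ereal"
  assumes "usc_on \<Omega> u" "K \<subseteq> \<Omega>" "K \<in> sets lebesgue"
  shows "u \<in> borel_measurable (lebesgue_on K)"
proof (rule borel_measurableI_less)
  fix y
  define W where "W = \<Union>{U. open U \<and> (\<forall>v\<in>U \<inter> K. u v < y)}"
  have "{x \<in> space (lebesgue_on K). u x < y} = W \<inter> K"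
  proof
    show "{x \<in> space (lebesgue_on K). u x < y} \<subseteq> W \<inter> K"
    proof
      fix x assume "x \<in> {x \<in> space (lebesgue_on K). u x < y}"
      then have x: "x \<in> K" "u x < y" by auto
      with assms have "\<forall>\<^sub>F v in at x within \<Omega>. u v < y" by (auto simp: usc_on_def)
      then obtain U where U: "open U" "x \<in> U" "\<forall>v\<in>U. v \<noteq> x \<longrightarrow> v \<in> \<Omega> \<longrightarrow> u v < y"
        by (auto simp: eventually_at_topological)
      have "\<forall>v\<in>U \<inter> K. u v < y"
      proof
        fix v assume "v \<in> U \<inter> K"
        then show "u v < y" using U(3) x(2) assms(2) by (cases "v = x") auto
      qed
      with U(1,2) x(1) show "x \<in> W \<inter> K" unfolding W_def by auto
    qed
  qed (auto simp: W_def)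
  moreover have "open W" unfolding W_def by (rule open_Union) simp
  then have "W \<in> sets lebesgue" by (intro sets_completionI_sets) (simp add: borel_open)
  ultimately show "{x \<in> space (lebesgue_on K). u x < y} \<in> sets (lebesgue_on K)"
    using assms(3) by (simp add: sets_restrict_space_iff)
qed

section \<open>Monomials: holomorphy, modulus and measurability of the weight\<close>

lemma monomial_nonneg:
  assumes "\<And>j. 0 \<le> \<alpha> $ j"
  shows "monomial \<alpha> = (\<lambda>z. \<Prod>j\<in>UNIV. (z $ j) ^ nat (\<alpha> $ j))"
  using assms by (simp add: monomial_def power_int_def fun_eq_iff)

lemma holomorphic_monomial:
  fixes \<alpha> :: "int ^ 'n"
  assumes "\<And>j. 0 \<le> \<alpha> $ j"
  shows "holomorphic_sev_on (monomial \<alpha>) V"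
  unfolding holomorphic_sev_on_def
proof
  fix z :: "complex ^ 'n"
  let ?D = "\<lambda>v. \<Sum>i\<in>UNIV. (of_nat (nat (\<alpha> $ i)) * (v $ i) * (z $ i) ^ (nat (\<alpha> $ i) - 1)) *
    (\<Prod>j\<in>UNIV - {i}. (z $ j) ^ nat (\<alpha> $ j))"
  have "(monomial \<alpha> has_derivative ?D) (at z)"
    unfolding monomial_nonneg[OF assms]
    by (intro has_derivative_prod has_derivative_power bounded_linear_imp_has_derivative bounded_linear_vec_nth)
  moreover have "?D (c *s v) = c * ?D v" for c v
    by (simp add: sum_distrib_left mult_ac)
  ultimately show "\<exists>D. (monomial \<alpha> has_derivative D) (at z) \<and> (\<forall>c v. D (c *s v) = c * D v)"
    by blast
qed

lemma cmod_monomial: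
  assumes "\<And>j. 0 \<le> \<alpha> $ j" "\<And>j. z $ j \<noteq> 0"
  shows "cmod (monomial \<alpha> z) = exp (\<Sum>j\<in>UNIV. of_int (\<alpha> $ j) * ln (cmod (z $ j)))"
proof -
  have "cmod (monomial \<alpha> z) = (\<Prod>j\<in>UNIV. cmod (z $ j) ^ nat (\<alpha> $ j))"
    by (simp add: monomial_nonneg[OF assms(1)] norm_power flip: prod_norm)
  also have "\<dots> = (\<Prod>j\<in>UNIV. exp (of_int (\<alpha> $ j) * ln (cmod (z $ j))))"
  proof (rule prod.cong[OF refl])
    fix j
    have "exp (real (nat (\<alpha> $ j)) * ln (cmod (z $ j))) = exp (ln (cmod (z $ j))) ^ nat (\<alpha> $ j)"
      by (rule exp_of_nat_mult)
    then show "cmod (z $ j) ^ nat (\<alpha> $ j) = exp (of_int (\<alpha> $ j) * ln (cmod (z $ j)))"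
      using assms(1)[of j] assms(2)[of j] by simp
  qed
  finally show ?thesis by (simp add: exp_sum)
qed

lemma measurable_monomial_weight:
  fixes u :: "complex ^ 'n \<Rightarrow> ereal"
  assumes "\<And>j. 0 \<le> \<alpha> $ j" "usc_on \<Omega> u" "K \<subseteq> \<Omega>" "compact K"
  shows "(\<lambda>z. ennreal (cmod (monomial \<alpha> z)) * eexp (- u z)) \<in> borel_measurable (lebesgue_on K)"
proof -
  have K: "K \<in> sets lebesgue" using assms(4) by (simp add: compact_imp_closed)
  have [measurable]: "u \<in> borel_measurable (lebesgue_on K)"
    by (rule usc_on_measurable_lebesgue[OF assms(2,3) K])
  have "continuous_on K (\<lambda>z. cmod (monomial \<alpha> z))"
    unfolding monomial_nonneg[OF assms(1)] by (intro continuous_intros)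
  from continuous_imp_measurable_on_sets_lebesgue[OF this K]
  have [measurable]: "(\<lambda>z. cmod (monomial \<alpha> z)) \<in> borel_measurable (lebesgue_on K)" .
  show ?thesis by measurable
qed

context multicircled_psh
begin

text \<open>
  Polar coordinates are avoided by \<open>\<bar>z\<^sub>j\<bar>\<^sup>2\<^sup>a \<le> \<bar>Re z\<^sub>j\<bar>\<^sup>a \<bar>Im z\<^sub>j\<bar>\<^sup>a\<close> for \<open>a < 0\<close>, which makes the majorant a
  product over the real coordinates.
\<close>

lemma growth_imp_multiplier_ideal:
  assumes \<alpha>: "\<And>j. 0 \<le> \<alpha> $ j" and \<epsilon>: "\<epsilon> > 0"
    and gr: "growth ((\<chi> j. of_int (\<alpha> $ j)) + 1 - \<epsilon> *\<^sub>R 1)"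
  shows "monomial \<alpha> \<in> multiplier_ideal u"
proof -
  obtain R0 C where R0: "\<And>s. (\<And>j. s $ j \<le> - R0) \<Longrightarrow> s \<in> D \<and>
      ereal (((\<chi> j. of_int (\<alpha> $ j)) + 1 - \<epsilon> *\<^sub>R 1) \<bullet> s - C) \<le> g s"
    using gr unfolding growth_def by blast
  \<comment> \<open>The 0 ensures |z_j| \<le> 1, so that the real coordinates lie in [-1, 1] and the
    s_j are nonpositive.\<close>
  define R where "R = max R0 0"
  define V :: "(complex ^ 'n) set" where "V = {z. \<forall>j. cmod (z $ j) < exp (- R)}"
  have "(\<chi> j. - R) \<in> D" using R0[of "\<chi> j. - R"] by (simp add: R_def)
  then have "- R < L" by (simp add: D_def)
  then have VL: "cmod (z $ j) < exp L" if "z \<in> V" for z j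
    using that by (auto simp: V_def intro: less_trans)
  have "V = (\<Inter>j. {z. cmod (z $ j) < exp (- R)})" by (auto simp: V_def)
  then have openV: "open V"
    by (auto intro!: open_INT open_Collect_less continuous_intros)
  have "0 \<in> V" by (simp add: V_def)
  \<comment> \<open>Above -1 for integrability, negative for the comparison with real and imaginary
    parts, and at most the exponent \<epsilon> - 1 left over after z^\<alpha> has been
    cancelled.\<close>
  define a where "a = min \<epsilon> (1 / 2) - 1"
  have a: "-1 < a" "a < 0" "a \<le> \<epsilon> - 1" using \<epsilon> by (auto simp: a_def)
  let ?F = "\<lambda>z. ennreal (cmod (monomial \<alpha> z)) * eexp (- u z)"
  let ?h = "\<lambda>x::real. ennreal (\<bar>x\<bar> powr a) * indicator {-1..1} x"
  \<comment> \<open>Points with a vanishing real coordinate are left out: as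
    \<open>0 powr a = 0\<close>, the majorant is 0 there. They form a null set.\<close>
  have bound: "(?F z)\<^sup>2 \<le> ennreal (exp (2 * C)) * (\<Prod>b\<in>Basis. ?h (z \<bullet> b))"
    if z: "z \<in> V" and nz: "\<And>b. b \<in> Basis \<Longrightarrow> z \<bullet> b \<noteq> 0" for z
  proof -
    define s where "s = (\<chi> j. ln (cmod (z $ j)))"
    have ReIm: "Re (z $ j) \<noteq> 0" "Im (z $ j) \<noteq> 0" for j
      using nz[of "axis j 1"] nz[of "axis j \<i>"]
      by (auto simp: inner_axis Basis_vec_def Basis_complex_def)
    then have zj: "z $ j \<noteq> 0" for j by (metis zero_complex.sel(1))
    have s_eq: "exp (s $ j) = cmod (z $ j)" for j using zj[of j] by (simp add: s_def)
    have sR: "s $ j \<le> - R" for j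
    proof -
      have "exp (s $ j) < exp (- R)" using z unfolding s_eq by (simp add: V_def)
      then show ?thesis by simp
    qed
    have s0: "s $ j \<le> 0" "cmod (z $ j) \<le> 1" for j
      using sR[of j] unfolding s_eq[symmetric] by (auto simp: R_def)
    let ?\<gamma> = "(\<chi> j. of_int (\<alpha> $ j)) + 1 - \<epsilon> *\<^sub>R 1 :: real ^ 'n"
    have "s $ j \<le> - R0" for j using sR[of j] by (simp add: R_def)
    then have "ereal (?\<gamma> \<bullet> s - C) \<le> g s" using R0 by blast
    also have "g s = u z" using u_eq_g[of z] zj VL[OF z] by (simp add: s_def)
    finally have "- u z \<le> ereal (C - ?\<gamma> \<bullet> s)"
      by (cases "u z") auto
    then have "eexp (- u z) \<le> ennreal (exp (C - ?\<gamma> \<bullet> s))"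
      using eexp_mono by fastforce
    then have "?F z \<le> ennreal (cmod (monomial \<alpha> z)) * ennreal (exp (C - ?\<gamma> \<bullet> s))"
      by (intro mult_left_mono) auto
    also have "\<dots> = ennreal (exp ((\<Sum>j\<in>UNIV. of_int (\<alpha> $ j) * s $ j) + (C - ?\<gamma> \<bullet> s)))"
      unfolding exp_add by (simp add: cmod_monomial[OF \<alpha> zj] s_def ennreal_mult)
    also have "\<dots> \<le> ennreal (exp (C + (\<Sum>j\<in>UNIV. a * s $ j)))"
    proof -
      have "(\<Sum>j\<in>UNIV. of_int (\<alpha> $ j) * s $ j) - ?\<gamma> \<bullet> s = (\<Sum>j\<in>UNIV. (\<epsilon> - 1) * s $ j)"
        unfolding inner_vec_def sum_subtractf[symmetric] by (intro sum.cong) (auto simp: algebra_simps)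
      also have "\<dots> \<le> (\<Sum>j\<in>UNIV. a * s $ j)"
        using a s0(1) by (intro sum_mono mult_right_mono_neg) auto
      finally show ?thesis by (intro ennreal_leI) simp
    qed
    finally have "(?F z)\<^sup>2 \<le> (ennreal (exp (C + (\<Sum>j\<in>UNIV. a * s $ j))))\<^sup>2"
      by (rule power_mono) simp
    also have "\<dots> = ennreal (exp (2 * C) * (\<Prod>j\<in>UNIV. exp (a * s $ j) * exp (a * s $ j)))"
    proof -
      have "(exp (C + (\<Sum>j\<in>UNIV. a * s $ j)))\<^sup>2 =
          exp (2 * C) * (exp (\<Sum>j\<in>UNIV. a * s $ j) * exp (\<Sum>j\<in>UNIV. a * s $ j))"
        by (simp add: power2_eq_square flip: exp_add)
      also have "\<dots> = exp (2 * C) * (\<Prod>j\<in>UNIV. exp (a * s $ j) * exp (a * s $ j))"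
        by (simp add: exp_sum prod.distrib)
      finally show ?thesis by (simp only: ennreal_power exp_ge_zero)
    qed
    also have "\<dots> \<le> ennreal (exp (2 * C) * (\<Prod>j\<in>UNIV. \<bar>Re (z $ j)\<bar> powr a * \<bar>Im (z $ j)\<bar> powr a))"
    proof (intro ennreal_leI mult_left_mono prod_mono conjI mult_mono)
      fix j
      have "exp (a * s $ j) = cmod (z $ j) powr a"
        using zj[of j] by (simp add: powr_def s_def)
      then show "exp (a * s $ j) \<le> \<bar>Re (z $ j)\<bar> powr a" "exp (a * s $ j) \<le> \<bar>Im (z $ j)\<bar> powr a"
        using a ReIm[of j] by (auto intro!: powr_mono2' abs_Re_le_cmod abs_Im_le_cmod)
    qed auto
    also have "(\<Prod>j\<in>UNIV. \<bar>Re (z $ j)\<bar> powr a * \<bar>Im (z $ j)\<bar> powr a) = (\<Prod>b\<in>Basis. \<bar>z \<bullet> b\<bar> powr a)"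
      by (rule prod_Basis_complex_vec[symmetric])
    also have "ennreal (exp (2 * C) * (\<Prod>b\<in>Basis. \<bar>z \<bullet> b\<bar> powr a)) =
        ennreal (exp (2 * C)) * (\<Prod>b\<in>Basis. ennreal (\<bar>z \<bullet> b\<bar> powr a))"
      by (simp add: ennreal_mult prod_ennreal prod_nonneg)
    also have "(\<Prod>b\<in>Basis. ennreal (\<bar>z \<bullet> b\<bar> powr a)) = (\<Prod>b\<in>Basis. ?h (z \<bullet> b))"
    proof (rule prod.cong[OF refl])
      fix b :: "complex ^ 'n" assume "b \<in> Basis"
      then obtain j v where b: "b = axis j v" "v \<in> Basis" by (auto simp: Basis_vec_def)
      have "\<bar>z \<bullet> b\<bar> \<le> cmod (z $ j)"
        using b(2) abs_Re_le_cmod abs_Im_le_cmod by (auto simp: b(1) inner_axis Basis_complex_def)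
      with s0(2)[of j] have "z \<bullet> b \<in> {-1..1}" by auto
      then show "ennreal (\<bar>z \<bullet> b\<bar> powr a) = ?h (z \<bullet> b)" by simp
    qed
    finally show ?thesis .
  qed
  have AE: "AE z in lborel. \<forall>b\<in>Basis. (z :: complex ^ 'n) \<bullet> b \<noteq> 0"
    by (intro AE_finite_allI AE_lborel_inner_neq) auto
  have "L2_loc_on V ?F"
    unfolding L2_loc_on_def
  proof (intro allI impI conjI)
    fix K assume K: "compact K \<and> K \<subseteq> V"
    then have K\<Omega>: "K \<subseteq> \<Omega>" using VL polydisc by blast
    show "?F \<in> borel_measurable (lebesgue_on K)"
      using psh K by (intro measurable_monomial_weight[OF \<alpha> _ K\<Omega>]) (auto simp: psh_on_def)
    have "K \<in> sets lebesgue" using K by (simp add: compact_imp_closed)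
    then have "(\<integral>\<^sup>+z. (?F z)\<^sup>2 \<partial>lebesgue_on K) = (\<integral>\<^sup>+z. (?F z)\<^sup>2 * indicator K z \<partial>lebesgue)"
      by (intro nn_integral_restrict_space) auto
    also have "\<dots> = (\<integral>\<^sup>+z. (?F z)\<^sup>2 * indicator K z \<partial>lborel)"
      by (rule nn_integral_completion)
    also have "\<dots> \<le> (\<integral>\<^sup>+z. ennreal (exp (2 * C)) * (\<Prod>b\<in>Basis. ?h ((z :: complex ^ 'n) \<bullet> b)) \<partial>lborel)"
    proof (rule nn_integral_mono_AE)
      show "AE z in lborel. (?F z)\<^sup>2 * indicator K z \<le> ennreal (exp (2 * C)) * (\<Prod>b\<in>Basis. ?h (z \<bullet> b))"
        using AE
      proof eventually_elim
        case (elim z)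
        show ?case
        proof (cases "z \<in> K")
          case True
          with K have "z \<in> V" by blast
          with bound[OF this] elim True show ?thesis by simp
        qed simp
      qed
    qed
    also have "\<dots> = ennreal (exp (2 * C)) * (\<integral>\<^sup>+z. (\<Prod>b\<in>Basis. ?h ((z :: complex ^ 'n) \<bullet> b)) \<partial>lborel)"
      by (rule nn_integral_cmult) measurable
    also have "(\<integral>\<^sup>+z. (\<Prod>b\<in>Basis. ?h ((z :: complex ^ 'n) \<bullet> b)) \<partial>lborel) =
        (\<Prod>b\<in>(Basis :: (complex ^ 'n) set). (\<integral>\<^sup>+x. ?h x \<partial>lborel))"
      by (rule nn_integral_lborel_prod) auto
    also have "ennreal (exp (2 * C)) * \<dots> < \<infinity>"
      using nn_integral_abs_powr_finite[OF a(1)]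
      by (auto simp: ennreal_mult_less_top power_less_top_ennreal)
    finally show "(\<integral>\<^sup>+z. (?F z)\<^sup>2 \<partial>lebesgue_on K) < \<infinity>" .
  qed
  with openV \<open>0 \<in> V\<close> holomorphic_monomial[OF \<alpha>] show ?thesis
    unfolding multiplier_ideal_def by blast
qed

end

section \<open>From square integrability to linear growth\<close>

lemma norm_complex_vec_le:
  fixes z :: "complex ^ 'n"
  assumes "\<And>j. cmod (z $ j) \<le> r"
  shows "norm z \<le> real CARD('n) * r"
proof -
  have "norm z \<le> (\<Sum>j\<in>UNIV. cmod (z $ j))" unfolding norm_vec_def by (rule L2_set_le_sum) simp
  also have "\<dots> \<le> (\<Sum>j\<in>(UNIV :: 'n set). r)" by (intro sum_mono assms)
  finally show ?thesis by simp
qed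

text \<open>As \<open>7 / 10 < 1 / sqrt 2\<close>, the upper corner still satisfies \<open>\<bar>z\<^sub>j\<bar> \<le> exp s\<^sub>j\<close>.\<close>

definition Qbox :: "real ^ 'n \<Rightarrow> (complex ^ 'n) set" where
  "Qbox s = cbox (\<chi> j. Complex (exp (s $ j) / 2) (exp (s $ j) / 2))
                 (\<chi> j. Complex (7 / 10 * exp (s $ j)) (7 / 10 * exp (s $ j)))"

lemma Qbox_cmod:
  fixes s :: "real ^ 'n"
  assumes "z \<in> Qbox s"
  shows "exp (s $ j) / 2 \<le> cmod (z $ j)" "cmod (z $ j) \<le> exp (s $ j)"
proof -
  have B: "axis j 1 \<in> (Basis :: (complex ^ 'n) set)" "axis j \<i> \<in> (Basis :: (complex ^ 'n) set)"
    by (auto simp: Basis_vec_def Basis_complex_def)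
  have box: "\<forall>b\<in>Basis. (\<chi> j. Complex (exp (s $ j) / 2) (exp (s $ j) / 2)) \<bullet> b \<le> z \<bullet> b \<and>
      z \<bullet> b \<le> (\<chi> j. Complex (7 / 10 * exp (s $ j)) (7 / 10 * exp (s $ j))) \<bullet> b"
    using assms unfolding Qbox_def mem_box .
  from bspec[OF box B(1)] have "exp (s $ j) / 2 \<le> Re (z $ j) \<and> Re (z $ j) \<le> 7 / 10 * exp (s $ j)"
    by (simp add: inner_axis)
  moreover from bspec[OF box B(2)]
  have "exp (s $ j) / 2 \<le> Im (z $ j) \<and> Im (z $ j) \<le> 7 / 10 * exp (s $ j)"
    by (simp add: inner_axis)
  ultimately have RI: "exp (s $ j) / 2 \<le> Re (z $ j)" "Re (z $ j) \<le> 7 / 10 * exp (s $ j)"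
    "exp (s $ j) / 2 \<le> Im (z $ j)" "Im (z $ j) \<le> 7 / 10 * exp (s $ j)" by auto
  show "exp (s $ j) / 2 \<le> cmod (z $ j)" using RI(1) complex_Re_le_cmod[of "z $ j"] by linarith
  have nn: "0 \<le> Re (z $ j)" "0 \<le> Im (z $ j)"
    using RI(1,3) exp_gt_zero[of "s $ j"] by linarith+
  have "(cmod (z $ j))\<^sup>2 = (Re (z $ j))\<^sup>2 + (Im (z $ j))\<^sup>2" by (rule cmod_power2)
  also have "\<dots> \<le> (7 / 10 * exp (s $ j))\<^sup>2 + (7 / 10 * exp (s $ j))\<^sup>2"
    using RI nn by (intro add_mono power_mono) auto
  also have "\<dots> \<le> (exp (s $ j))\<^sup>2" by (simp add: power2_eq_square)
  finally show "cmod (z $ j) \<le> exp (s $ j)" by (rule power2_le_imp_le) simp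
qed

text \<open>The squares have side (7/10 - 1/2) exp (s_j), hence the factor 1/25. The exponential is
  the Jacobian of the logarithmic change of variables, obtained here from volumes of boxes
  alone.\<close>

lemma emeasure_Qbox:
  fixes s :: "real ^ 'n"
  shows "emeasure lborel (Qbox s) = ennreal ((1 / 25) ^ CARD('n) * exp (2 * (\<Sum>j\<in>UNIV. s $ j)))"
proof -
  let ?l = "(\<chi> j. Complex (exp (s $ j) / 2) (exp (s $ j) / 2)) :: complex ^ 'n"
  let ?u = "(\<chi> j. Complex (7 / 10 * exp (s $ j)) (7 / 10 * exp (s $ j))) :: complex ^ 'n"
  have "\<forall>b\<in>Basis. ?l \<bullet> b \<le> ?u \<bullet> b"
    by (auto simp: Basis_vec_def Basis_complex_def inner_axis)
  then have "emeasure lborel (Qbox s) = ennreal (\<Prod>b\<in>Basis. (?u - ?l) \<bullet> b)"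
    unfolding Qbox_def emeasure_lborel_cbox_eq by simp
  also have "(\<Prod>b\<in>Basis. (?u - ?l) \<bullet> b) = (\<Prod>j\<in>UNIV. Re ((?u - ?l) $ j) * Im ((?u - ?l) $ j))"
    by (rule prod_Basis_complex_vec)
  also have "\<dots> = (\<Prod>j\<in>UNIV. 1 / 25 * exp (2 * s $ j))"
  proof (rule prod.cong[OF refl])
    fix j
    have "Re ((?u - ?l) $ j) = 1 / 5 * exp (s $ j)" "Im ((?u - ?l) $ j) = 1 / 5 * exp (s $ j)" by simp_all
    moreover have "exp (2 * s $ j) = exp (s $ j) * exp (s $ j)" by (simp flip: exp_add)
    ultimately show "Re ((?u - ?l) $ j) * Im ((?u - ?l) $ j) = 1 / 25 * exp (2 * s $ j)" by simp
  qed
  also have "\<dots> = (1 / 25) ^ CARD('n) * exp (2 * (\<Sum>j\<in>UNIV. s $ j))"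
    unfolding prod.distrib sum_distrib_left by (simp add: exp_sum)
  finally show ?thesis .
qed

context multicircled_psh
begin

text \<open>
  The integral over the part of the polydisc where some \<open>\<bar>z\<^sub>j\<bar> \<le> e\<^sup>-\<^sup>m\<close> tends to \<open>0\<close>, while over
  \<open>Qbox s\<close> it is at least a constant times \<open>exp (2 (\<beta> \<bullet> s - g s))\<close>.
\<close>

lemma coercive_of_multiplier_ideal:
  assumes \<alpha>: "\<And>j. 0 \<le> \<alpha> $ j" and mem: "monomial \<alpha> \<in> multiplier_ideal u"
  defines "\<beta> \<equiv> (\<chi> j. of_int (\<alpha> $ j)) + 1"
  shows "\<exists>R. - R < L \<and> (\<forall>H. \<exists>m>R. \<forall>s c. (\<forall>j. s $ j \<le> - R) \<longrightarrow> (\<exists>j. s $ j \<le> - m) \<longrightarrow>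
    g s \<le> ereal c \<longrightarrow> H < c - \<beta> \<bullet> s)"
proof -
  let ?F = "\<lambda>z. ennreal (cmod (monomial \<alpha> z)) * eexp (- u z)"
  obtain V where V: "open V" "0 \<in> V" "L2_loc_on V ?F"
    using mem unfolding multiplier_ideal_def by blast
  obtain d where d: "d > 0" "ball 0 d \<subseteq> V" using V(1,2) by (rule openE)
  define n where "n = real CARD('n)"
  have n: "n > 0" by (simp add: n_def)
  \<comment> \<open>Makes the polydisc of radius exp (-R) fit both into that of radius exp L and
    into the ball of radius d inside V.\<close>
  define R where "R = max (1 - L) (1 - ln (d / n))"
  define K :: "(complex ^ 'n) set" where "K = {z. \<forall>j. cmod (z $ j) \<le> exp (- R)}"
  have RL: "- R < L" by (simp add: R_def max_def)
  have "exp (- R) < exp (ln (d / n))" unfolding exp_less_cancel_iff by (simp add: R_def max_def)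
  then have Rd: "n * exp (- R) < d" using d n by (simp add: field_simps)
  have normK: "norm z \<le> n * exp (- R)" if "z \<in> K" for z
    unfolding n_def using that by (intro norm_complex_vec_le) (simp add: K_def)
  have KV: "K \<subseteq> V" using normK Rd d(2) by (force simp: dist_norm)
  have "K = (\<Inter>j. {z. cmod (z $ j) \<le> exp (- R)})" by (auto simp: K_def)
  then have "closed K" by (auto intro!: closed_INT closed_Collect_le continuous_intros)
  moreover have "bounded K" by (rule boundedI[OF normK])
  ultimately have cK: "compact K" by (simp add: compact_eq_bounded_closed)
  then have Kleb: "K \<in> sets lebesgue" by (simp add: compact_imp_closed)
  have Fm: "?F \<in> borel_measurable (lebesgue_on K)" and Ffin: "(\<integral>\<^sup>+z. (?F z)\<^sup>2 \<partial>lebesgue_on K) < \<infinity>"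
    using V(3) cK KV unfolding L2_loc_on_def by auto
  \<comment> \<open>Removing the coordinate hyperplanes makes these sets decrease to the empty set,
    so the integrands tend to 0 at every point.\<close>
  define E :: "nat \<Rightarrow> (complex ^ 'n) set" where
    "E = (\<lambda>m. {z \<in> K. (\<forall>j. z $ j \<noteq> 0) \<and> (\<exists>j. cmod (z $ j) \<le> exp (- real m))})"
  have Esets: "E m \<in> sets (lebesgue_on K)" for m
  proof -
    have "open (\<Inter>j. {z :: complex ^ 'n. z $ j \<noteq> 0})"
      by (auto intro!: open_INT open_Collect_neq continuous_intros)
    moreover have "closed (\<Union>j. {z :: complex ^ 'n. cmod (z $ j) \<le> exp (- real m)})"
      by (auto intro!: closed_UN closed_Collect_le continuous_intros)
    ultimately have "(\<Inter>j. {z. z $ j \<noteq> 0}) \<inter> (\<Union>j. {z. cmod (z $ j) \<le> exp (- real m)}) \<in> sets (lebesgue :: (complex ^ 'n) measure)"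
      by (intro sets.Int sets_completionI_sets) (auto intro: borel_open borel_closed)
    then have "K \<inter> ((\<Inter>j. {z. z $ j \<noteq> 0}) \<inter> (\<Union>j. {z. cmod (z $ j) \<le> exp (- real m)})) \<in> sets lebesgue"
      using Kleb by (rule sets.Int[rotated])
    also have "K \<inter> ((\<Inter>j. {z. z $ j \<noteq> 0}) \<inter> (\<Union>j. {z. cmod (z $ j) \<le> exp (- real m)})) = E m"
      by (auto simp: E_def)
    finally show ?thesis using Kleb by (simp add: sets_restrict_space_iff E_def)
  qed
  define f where "f = (\<lambda>m z. (?F z)\<^sup>2 * indicator (E m) z)"
  have "decseq f"
  proof (rule decseq_SucI, rule le_funI)
    fix m z
    have "E (Suc m) \<subseteq> E m"
    proof
      fix z assume z: "z \<in> E (Suc m)"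
      then obtain j where "cmod (z $ j) \<le> exp (- real (Suc m))" unfolding E_def by blast
      also have "\<dots> \<le> exp (- real m)" by simp
      finally show "z \<in> E m" using z unfolding E_def by blast
    qed
    then show "f (Suc m) z \<le> f m z" unfolding f_def by (auto simp: indicator_def)
  qed
  moreover have "f m \<in> borel_measurable (lebesgue_on K)" for m
    unfolding f_def using Fm Esets[of m] by measurable
  moreover have "(\<integral>\<^sup>+z. f m z \<partial>lebesgue_on K) < \<infinity>" for m
  proof (rule le_less_trans[OF _ Ffin], rule nn_integral_mono)
    show "f m z \<le> (?F z)\<^sup>2" for z unfolding f_def by (simp add: indicator_def)
  qed
  ultimately have INF: "(\<integral>\<^sup>+z. (INF m. f m z) \<partial>lebesgue_on K) = (INF m. \<integral>\<^sup>+z. f m z \<partial>lebesgue_on K)"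
    by (rule nn_integral_monotone_convergence_INF_decseq)
  have "(INF m. f m z) = 0" for z
  proof -
    have "\<exists>m. z \<notin> E m"
    proof (cases "\<forall>j. z $ j \<noteq> 0")
      case True
      define \<mu> where "\<mu> = Min (range (\<lambda>j. cmod (z $ j)))"
      have "\<mu> > 0" using True by (simp add: \<mu>_def)
      obtain m :: nat where m: "- ln \<mu> < real m" using reals_Archimedean2 by blast
      then have "exp (- real m) < exp (ln \<mu>)" by simp
      then have "exp (- real m) < \<mu>" using \<open>\<mu> > 0\<close> by simp
      also have "\<mu> \<le> cmod (z $ j)" for j unfolding \<mu>_def by (intro Min_le) auto
      finally have "exp (- real m) < cmod (z $ j)" for j .
      then show ?thesis by (auto simp: E_def not_le)
    qed (auto simp: E_def)
    then obtain m where "z \<notin> E m" by blast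
    then have "f m z = 0" by (simp add: f_def)
    moreover have "(INF m. f m z) \<le> f m z" by (rule INF_lower) simp
    ultimately show ?thesis by simp
  qed
  with INF have INF0: "(INF m. \<integral>\<^sup>+z. f m z \<partial>lebesgue_on K) = 0" by simp
  \<comment> \<open>On \<open>Qbox s\<close> one has |z_j| \<ge> exp (s_j) / 2; A is the resulting
    loss in the logarithm of |z^\<alpha>|, and \<kappa> combines its effect on the square with the
    volume constant.\<close>
  define A where "A = (\<Sum>j\<in>UNIV. of_int (\<alpha> $ j) * ln 2 :: real)"
  define \<kappa> where "\<kappa> = exp (- 2 * A) * (1 / 25) ^ CARD('n)"
  have \<kappa>: "\<kappa> > 0" by (simp add: \<kappa>_def)
  have lower: "ennreal (\<kappa> * exp (2 * (\<beta> \<bullet> s - c))) \<le> (\<integral>\<^sup>+z. f m z \<partial>lebesgue_on K)"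
    if s: "\<And>j. s $ j \<le> - R" and sm: "\<exists>j. s $ j \<le> - real m" and c: "g s \<le> ereal c" for s c m
  proof -
    let ?\<Sigma> = "\<Sum>j\<in>UNIV. of_int (\<alpha> $ j) * s $ j :: real"
    have sD: "s \<in> D" using s RL by (auto simp: D_def intro: le_less_trans)
    have QE: "Qbox s \<subseteq> E m"
    proof
      fix z assume z: "z \<in> Qbox s"
      have "cmod (z $ j) \<le> exp (- R)" for j
        using Qbox_cmod(2)[OF z, of j] s[of j] by (auto intro: order_trans)
      moreover have "z $ j \<noteq> 0" for j
        using Qbox_cmod(1)[OF z, of j] by auto
      moreover obtain j where "s $ j \<le> - real m" using sm by blast
      then have "cmod (z $ j) \<le> exp (- real m)"
        using Qbox_cmod(2)[OF z, of j] by (auto intro: order_trans)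
      ultimately show "z \<in> E m" by (auto simp: E_def K_def)
    qed
    have Fge: "ennreal (exp (2 * (?\<Sigma> - A - c))) \<le> (?F z)\<^sup>2" if z: "z \<in> Qbox s" for z
    proof -
      have zj: "z $ j \<noteq> 0" for j using Qbox_cmod(1)[OF z, of j] by auto
      have "?\<Sigma> - A = (\<Sum>j\<in>UNIV. of_int (\<alpha> $ j) * (s $ j - ln 2))"
        by (simp add: A_def right_diff_distrib sum_subtractf)
      also have "\<dots> \<le> (\<Sum>j\<in>UNIV. of_int (\<alpha> $ j) * ln (cmod (z $ j)))"
      proof (intro sum_mono mult_left_mono)
        fix j
        have "ln (exp (s $ j) / 2) \<le> ln (cmod (z $ j))"
          using Qbox_cmod(1)[OF z, of j] zj[of j] by (subst ln_le_cancel_iff) auto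
        then show "s $ j - ln 2 \<le> ln (cmod (z $ j))" by (simp add: ln_div)
      qed (use \<alpha> in auto)
      finally have "exp (?\<Sigma> - A) \<le> cmod (monomial \<alpha> z)"
        by (simp add: cmod_monomial[OF \<alpha> zj])
      moreover have "ennreal (exp (- c)) \<le> eexp (- u z)"
      proof -
        have "u z \<le> ereal c" using u_le_g[OF sD Qbox_cmod(2)[OF z]] c by (rule order_trans)
        then have "ereal (- c) \<le> - u z" by (cases "u z") auto
        from eexp_mono[OF this] show ?thesis by simp
      qed
      ultimately have "ennreal (exp (?\<Sigma> - A)) * ennreal (exp (- c)) \<le> ?F z"
        by (intro mult_mono ennreal_leI) auto
      then have "(ennreal (exp (?\<Sigma> - A)) * ennreal (exp (- c)))\<^sup>2 \<le> (?F z)\<^sup>2"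
        by (rule power_mono) simp
      also have "ennreal (exp (?\<Sigma> - A)) * ennreal (exp (- c)) = ennreal (exp (?\<Sigma> - A - c))"
        by (simp add: exp_diff exp_minus divide_inverse flip: ennreal_mult)
      also have "(ennreal (exp (?\<Sigma> - A - c)))\<^sup>2 = ennreal (exp (2 * (?\<Sigma> - A - c)))"
        by (simp add: ennreal_power flip: exp_of_nat_mult)
      finally show ?thesis .
    qed
    have "\<beta> \<bullet> s = ?\<Sigma> + (\<Sum>j\<in>UNIV. s $ j)"
      by (simp add: \<beta>_def inner_vec_def distrib_right sum.distrib)
    then have "\<kappa> * exp (2 * (\<beta> \<bullet> s - c)) =
        exp (2 * (?\<Sigma> - A - c)) * ((1 / 25) ^ CARD('n) * exp (2 * (\<Sum>j\<in>UNIV. s $ j)))"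
      unfolding \<kappa>_def by (simp add: algebra_simps flip: exp_add)
    then have "ennreal (\<kappa> * exp (2 * (\<beta> \<bullet> s - c))) = ennreal (exp (2 * (?\<Sigma> - A - c))) * emeasure lborel (Qbox s)"
      unfolding emeasure_Qbox by (simp flip: ennreal_mult)
    also have "\<dots> = (\<integral>\<^sup>+z. ennreal (exp (2 * (?\<Sigma> - A - c))) * indicator (Qbox s) z \<partial>lborel)"
      by (rule nn_integral_cmult_indicator[symmetric]) (simp add: Qbox_def)
    also have "\<dots> \<le> (\<integral>\<^sup>+z. f m z * indicator K z \<partial>lborel)"
    proof (rule nn_integral_mono)
      fix z
      show "ennreal (exp (2 * (?\<Sigma> - A - c))) * indicator (Qbox s) z \<le> f m z * indicator K z"
      proof (cases "z \<in> Qbox s")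
        case True
        then have "z \<in> E m" "z \<in> K" using QE by (auto simp: E_def)
        then show ?thesis using Fge[OF True] True by (simp add: f_def)
      qed simp
    qed
    also have "\<dots> = (\<integral>\<^sup>+z. f m z * indicator K z \<partial>lebesgue)"
      by (rule nn_integral_completion[symmetric])
    also have "\<dots> = (\<integral>\<^sup>+z. f m z \<partial>lebesgue_on K)"
      using Kleb by (intro nn_integral_restrict_space[symmetric]) auto
    finally show ?thesis .
  qed
  have "\<exists>m>R. \<forall>s c. (\<forall>j. s $ j \<le> - R) \<longrightarrow> (\<exists>j. s $ j \<le> - m) \<longrightarrow> g s \<le> ereal c \<longrightarrow> H < c - \<beta> \<bullet> s" for H
  proof -
    \<comment> \<open>A tail integral below \<kappa> exp (-2 H) forces 2 (\<beta> . s - c) < -2 H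
      through the lower bound on boxes.\<close>
    have "(INF m. \<integral>\<^sup>+z. f m z \<partial>lebesgue_on K) < ennreal (\<kappa> * exp (- 2 * H))"
      unfolding INF0 using \<kappa> by simp
    then obtain m where m: "(\<integral>\<^sup>+z. f m z \<partial>lebesgue_on K) < ennreal (\<kappa> * exp (- 2 * H))"
      by (auto simp: INF_less_iff)
    have "H < c - \<beta> \<bullet> s"
      if s: "\<forall>j. s $ j \<le> - R" "\<exists>j. s $ j \<le> - max (real m) (R + 1)" "g s \<le> ereal c" for s c
    proof -
      obtain j where "s $ j \<le> - max (real m) (R + 1)" using s(2) by blast
      then have "s $ j \<le> - real m" by linarith
      then have "ennreal (\<kappa> * exp (2 * (\<beta> \<bullet> s - c))) < ennreal (\<kappa> * exp (- 2 * H))"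
        using s(1,3) by (intro le_less_trans[OF lower m]) auto
      then have "\<kappa> * exp (2 * (\<beta> \<bullet> s - c)) < \<kappa> * exp (- 2 * H)"
        by (rule ennreal_less_iff[THEN iffD1, rotated]) (use \<kappa> in simp)
      then have "2 * (\<beta> \<bullet> s - c) < - 2 * H" using \<kappa> by simp
      then show ?thesis by simp
    qed
    then show ?thesis by (intro exI[of _ "max (real m) (R + 1)"]) auto
  qed
  with RL show ?thesis by blast
qed

text \<open>
  Convexity along rays from the corner \<open>(-R, \<dots>, -R)\<close> turns divergence to infinity into linear growth.
\<close>

lemma multiplier_ideal_imp_growth:
  assumes \<alpha>: "\<And>j. 0 \<le> \<alpha> $ j" and mem: "monomial \<alpha> \<in> multiplier_ideal u"
  shows "\<exists>\<epsilon>>0. growth ((\<chi> j. of_int (\<alpha> $ j)) + 1 - \<epsilon> *\<^sub>R 1)"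
proof -
  define \<beta> :: "real ^ 'n" where "\<beta> = (\<chi> j. of_int (\<alpha> $ j)) + 1"
  obtain R where RL: "- R < L" and co: "\<And>H. \<exists>m>R. \<forall>s c. (\<forall>j. s $ j \<le> - R) \<longrightarrow> (\<exists>j. s $ j \<le> - m) \<longrightarrow>
    g s \<le> ereal c \<longrightarrow> H < c - \<beta> \<bullet> s"
    using coercive_of_multiplier_ideal[OF \<alpha> mem] unfolding \<beta>_def by blast
  define s0 :: "real ^ 'n" where "s0 = (\<chi> j. - R)"
  \<comment> \<open>An upper bound for g s - \<beta> . s at the corner; reaching the level h0 + 1
    far out is a gain of 1.\<close>
  define h0 where "h0 = M - \<beta> \<bullet> s0"
  obtain m where m: "m > R" and mH: "\<And>s c. (\<And>j. s $ j \<le> - R) \<Longrightarrow> (\<exists>j. s $ j \<le> - m) \<Longrightarrow>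
    g s \<le> ereal c \<Longrightarrow> h0 + 1 < c - \<beta> \<bullet> s"
    using co[of "h0 + 1"] by blast
  define n where "n = real CARD('n)"
  have n: "n > 0" by (simp add: n_def)
  \<comment> \<open>The gain of 1 divided by the l^1 distance over which it is achieved.\<close>
  define \<epsilon> where "\<epsilon> = 1 / (n * (m - R))"
  have \<epsilon>: "\<epsilon> > 0" using n m by (simp add: \<epsilon>_def)
  have inD: "s \<in> D" if "\<And>j. s $ j \<le> - R" for s
    using that RL by (auto simp: D_def intro: le_less_trans)
  have s0D: "s0 \<in> D" by (rule inD) (simp add: s0_def)
  have "s \<in> D \<and> ereal ((\<beta> - \<epsilon> *\<^sub>R 1) \<bullet> s - (\<epsilon> * n * R - h0)) \<le> g s" if s: "\<And>j. s $ j \<le> - m" for s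
  proof
    have sR: "s $ j \<le> - R" for j using s[of j] m by simp
    show sD: "s \<in> D" by (rule inD[OF sR])
    show "ereal ((\<beta> - \<epsilon> *\<^sub>R 1) \<bullet> s - (\<epsilon> * n * R - h0)) \<le> g s"
    proof (rule ereal_le_real)
      fix c assume c: "g s \<le> ereal c"
      define d where "d = (\<Sum>j\<in>UNIV. - s $ j - R)"
      have "(\<Sum>j\<in>(UNIV :: 'n set). m - R) \<le> d" unfolding d_def
      proof (rule sum_mono)
        show "m - R \<le> - s $ j - R" for j using s[of j] by simp
      qed
      then have d: "n * (m - R) \<le> d" by (simp add: n_def)
      have nm: "0 < n * (m - R)" using n m by simp
      \<comment> \<open>Puts p on the segment from the corner to s at l^1 distance n (m - R) from
        the corner. By averaging, some coordinate of p is then at most -m, so \<open>mH\<close>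
        applies to p.\<close>
      define l where "l = n * (m - R) / d"
      have l: "0 < l" "l \<le> 1" "l * d = n * (m - R)" using d nm by (auto simp: l_def)
      define p where "p = (1 - l) *\<^sub>R s0 + l *\<^sub>R s"
      have pj: "- p $ j - R = l * (- s $ j - R)" for j by (simp add: p_def s0_def algebra_simps)
      have "p $ j \<le> - R" for j
      proof -
        have "0 \<le> l * (- s $ j - R)" using l sR[of j] by simp
        then show ?thesis using pj[of j] by simp
      qed
      moreover have "\<exists>j. p $ j \<le> - m"
      proof (rule ccontr)
        assume "\<not> ?thesis"
        then have "- m < p $ j" for j by (simp add: not_le)
        then have "- p $ j - R < m - R" for j using minus_less_iff[of m "p $ j"] by simp
        then have "(\<Sum>j\<in>UNIV. - p $ j - R) < (\<Sum>j\<in>(UNIV :: 'n set). m - R)"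
          by (intro sum_strict_mono) auto
        moreover have "(\<Sum>j\<in>UNIV. - p $ j - R) = l * d"
          unfolding pj d_def sum_distrib_left ..
        ultimately show False using l(3) by (simp add: n_def)
      qed
      moreover have "g p \<le> ereal ((1 - l) * M + l * c)"
        unfolding p_def using l by (intro g_convexD s0D sD g_le c) auto
      \<comment> \<open>A gain above 1 at the fraction l of the segment becomes, by convexity, a
        gain above 1 / l = \<epsilon> d at s.\<close>
      ultimately have "h0 + 1 < (1 - l) * M + l * c - \<beta> \<bullet> p" by (rule mH)
      also have "\<dots> = h0 + l * (c - \<beta> \<bullet> s - h0)"
        by (simp add: p_def h0_def inner_add_right algebra_simps)
      finally have "1 / l < c - \<beta> \<bullet> s - h0" using l(1) by (simp add: field_simps)
      moreover have "1 / l = \<epsilon> * d" using l(1) nm by (simp add: l_def \<epsilon>_def)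
      moreover have "d = - (\<Sum>j\<in>UNIV. s $ j) - n * R"
        by (simp add: d_def n_def sum_subtractf sum_negf)
      then have "\<epsilon> * d = - (\<epsilon> * (\<Sum>j\<in>UNIV. s $ j)) - \<epsilon> * n * R"
        by (simp add: right_diff_distrib)
      moreover have "(\<beta> - \<epsilon> *\<^sub>R 1) \<bullet> s = \<beta> \<bullet> s - \<epsilon> * (\<Sum>j\<in>UNIV. s $ j)"
        unfolding inner_diff_left by (simp add: inner_vec_def sum_distrib_left)
      ultimately have "(\<beta> - \<epsilon> *\<^sub>R 1) \<bullet> s - (\<epsilon> * n * R - h0) \<le> c"
        by linarith
      then show "ereal ((\<beta> - \<epsilon> *\<^sub>R 1) \<bullet> s - (\<epsilon> * n * R - h0)) \<le> ereal c" by simp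
    qed
  qed
  then have "growth (\<beta> - \<epsilon> *\<^sub>R 1)" unfolding growth_def by blast
  with \<epsilon> show ?thesis unfolding \<beta>_def by blast
qed

end

theorem proposition3p1:
  fixes u :: "complex ^ 'n \<Rightarrow> ereal" and \<alpha> :: "int ^ 'n"
  assumes "multi_circled_singularity u"
    and "\<And>j. 0 \<le> \<alpha> $ j"
  shows "monomial \<alpha> \<in> multiplier_ideal u \<longleftrightarrow>
         (\<chi> j. of_int (\<alpha> $ j)) + 1 \<in> interior (indicator_diagram u)"
proof -
  obtain \<Omega> where \<Omega>: "open \<Omega>" "0 \<in> \<Omega>" "psh_on \<Omega> u"
    using assms(1) unfolding multi_circled_singularity_def by blast
  have circ: "\<forall>\<^sub>F z in nhds 0. u z = u (\<chi> j. complex_of_real (cmod (z $ j)))"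
    using assms(1) unfolding multi_circled_singularity_def by blast
  have "u 0 < \<infinity>" using \<Omega> by (auto simp: psh_on_def)
  then obtain M where M: "u 0 < ereal M" using ereal_dense2 by blast
  with \<Omega> have "\<forall>\<^sub>F z in at 0 within \<Omega>. u z < ereal M" unfolding psh_on_def usc_on_def by blast
  then have "\<forall>\<^sub>F z in nhds 0. z \<in> \<Omega> \<longrightarrow> u z < ereal M"
    unfolding eventually_at_filter by (rule eventually_mono) (use M in auto)
  moreover have "\<forall>\<^sub>F z in nhds 0. z \<in> \<Omega>" using \<Omega>(1,2) by (rule eventually_nhds_in_open)
  ultimately have "\<forall>\<^sub>F z in nhds 0. z \<in> \<Omega> \<and> u z \<le> ereal M \<and> u z = u (\<chi> j. complex_of_real (cmod (z $ j)))"
    using circ by eventually_elim auto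
  then obtain e where e: "e > 0" "\<And>z. dist z 0 < e \<Longrightarrow>
      z \<in> \<Omega> \<and> u z \<le> ereal M \<and> u z = u (\<chi> j. complex_of_real (cmod (z $ j)))"
    unfolding eventually_nhds_metric by blast
  define n where "n = real CARD('n)"
  have n: "n > 0" by (simp add: n_def)
  \<comment> \<open>The norm is at most n times the largest modulus, so the polydisc of radius exp L
    lies in the ball of radius e; the -1 makes the inequality strict.\<close>
  define L where "L = ln (e / n) - 1"
  have "exp L < exp (ln (e / n))" by (simp add: L_def)
  then have L: "n * exp L < e" using e n by (simp add: field_simps)
  have near: "dist z 0 < e" if "\<And>j. cmod (z $ j) < exp L" for z :: "complex ^ 'n"
  proof -
    have "norm z \<le> n * exp L" unfolding n_def by (rule norm_complex_vec_le) (use that in \<open>auto intro: less_imp_le\<close>)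
    with L show ?thesis by simp
  qed
  interpret multicircled_psh u \<Omega> L M
    by unfold_locales (use \<Omega>(3) e(2) near in blast)+
  have "0 < ((\<chi> j. of_int (\<alpha> $ j)) + 1 :: real ^ 'n) $ j" for j
    using assms(2)[of j] by (simp add: add_nonneg_pos)
  from interior_indicator_diagram_iff_growth[OF this] show ?thesis
    using growth_imp_multiplier_ideal[OF assms(2)] multiplier_ideal_imp_growth[OF assms(2)] by blast
qed

end
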